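(* Let $p$ be a prime, $q=p^l$, $n\ge 2$ and $k\ge1$ integers, and $d=\gcd(k,q-1)$. If $q>d^2$, $p\nmid k$, and $p\in\{2,3\}$, then for $n>\max\left\{3,\frac{4\ln(k-1)}{\ln q}\right\}$ every matrix in $M_n(\mathbb F_q)$ is of the form $A^k+B^k$ with $A,B\in M_n(\mathbb F_q)$.
   Context: Convention: $\ln(0)=-\infty$ (relevant when $k=1$). *)

theory Defs
  imports
    "HOL-Library.Cardinality"
    "HOL-Library.Extended_Real"
    "HOL-Computational_Algebra.Primes"
    "Jordan_Normal_Form.Matrix"
begin

(* Natural logarithm on the nonnegative reals with the convention ln 0 = -\<infinity>;
   the library's ln on the reals has ln 0 = 0 instead. *)
definition eln :: "real \<Rightarrow> ereal" where
  "eln x = (if x = 0 then -\<infinity> else ereal (ln x))"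

end

theory Submission
  imports
    Defs
    "Jordan_Normal_Form.Determinant"
    "HOL-Algebra.Algebraic_Closure_Type"
    "HOL-Analysis.Convex"
    "HOL-Number_Theory.Residues"
begin

text \<open>
  A scalar matrix \<open>c I\<close> is treated in the field with \<open>q ^ n\<close> elements, which acts on an
  \<open>n\<close>-dimensional space over the ground field: since \<open>q ^ n > (k - 1) ^ 4\<close>, the bound
  \<open>sqrt (q ^ n)\<close> for Jacobi sums shows that \<open>x ^ k + y ^ k = c\<close> has a solution there.

  A nonscalar matrix is similar to one with any prescribed diagonal of the right trace, and a
  matrix whose diagonal entries are sums of two nonzero \<open>k\<close>-th powers is the sum of an upper and a lower
  triangular matrix having \<open>k\<close>-th roots. Since \<open>n \<ge> 4\<close>, it suffices that every field element be a
  sum of eight nonzero \<open>k\<close>-th powers. For \<open>q > 2\<close> this follows from the group of nonzero \<open>k\<close>-th powers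
  having more than \<open>sqrt q\<close> elements, which is where \<open>p \<in> {2, 3}\<close> enters (it excludes
  \<open>q = d\<^sup>2 + 1\<close>); for \<open>q = 2\<close> one diagonal entry of one of the triangular matrices is allowed to be zero.
\<close>

text \<open>Conjugation fixes a scalar matrix, so its diagonal cannot be redistributed; hence the
  detour through an extension field. The exponent 4 comes from there: with Q = q^n and e = gcd(k, Q
  - 1) there are (e - 1)^2 nontrivial Jacobi sums, each at most sqrt Q, and their total stays below
  the main term Q once (e - 1)^4 < Q. Roots of triangular matrices are built one column at a time.
  The new column is found by inverting a geometric sum of powers, whose diagonal entries are either
  quotients (a^k - s^k)/(a - s) or of the form k s^(k - 1). The second kind is why p must not divide
  k and why at most one diagonal entry may be zero; this in turn is why the powers on the diagonal
  are asked to be nonzero.\<close>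

hide_const (open) Divisibility.prime Polynomials.degree Polynomials.lead_coeff UnivPoly.monom
unbundle no fps_syntax

section \<open>Roots of triangular matrices\<close>

(* geom_sum_mat A s k = \<Sum>i<k. s ^ (k - 1 - i) A ^ i *)
fun geom_sum_mat :: "'a :: comm_ring_1 mat \<Rightarrow> 'a \<Rightarrow> nat \<Rightarrow> 'a mat" where
  "geom_sum_mat A s 0 = 0\<^sub>m (dim_row A) (dim_row A)"
| "geom_sum_mat A s (Suc k) = A ^\<^sub>m k + s \<cdot>\<^sub>m geom_sum_mat A s k"

lemma geom_sum_mat_carrier:
  "A \<in> carrier_mat n n \<Longrightarrow> geom_sum_mat A s k \<in> carrier_mat n n"
  by (induction k) auto

lemma upper_triangular_mult_diag:
  fixes A B :: "'a :: comm_ring_1 mat"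
  assumes A: "A \<in> carrier_mat n n" and B: "B \<in> carrier_mat n n"
    and uA: "upper_triangular A" and uB: "upper_triangular B"
  shows "upper_triangular (A * B)" and "i < n \<Longrightarrow> (A * B) $$ (i,i) = A $$ (i,i) * B $$ (i,i)"
proof -
  have entry: "(A * B) $$ (i,j) = (\<Sum>l = 0..<n. A $$ (i,l) * B $$ (l,j))" if "i < n" "j < n" for i j
    using A B that by (simp add: scalar_prod_def)
  show "upper_triangular (A * B)"
  proof (rule upper_triangularI)
    fix i j assume ij: "j < i" "i < dim_row (A * B)"
    have "A $$ (i,l) * B $$ (l,j) = 0" if "l < n" for l
      using ij that A B upper_triangularD[OF uA, of l i] upper_triangularD[OF uB, of j l]
      by (cases "l < i") auto
    then show "(A * B) $$ (i,j) = 0" using ij A by (simp add: entry)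
  qed
  assume i: "i < n"
  have "A $$ (i,l) * B $$ (l,i) = (if l = i then A $$ (i,i) * B $$ (i,i) else 0)" if "l < n" for l
    using i that A B upper_triangularD[OF uA, of l i] upper_triangularD[OF uB, of i l]
    by (cases l i rule: linorder_cases) auto
  then have "(\<Sum>l = 0..<n. A $$ (i,l) * B $$ (l,i)) = (\<Sum>l = 0..<n. if l = i then A $$ (i,i) * B $$ (i,i) else 0)"
    by (intro sum.cong) auto
  then show "(A * B) $$ (i,i) = A $$ (i,i) * B $$ (i,i)" using i by (simp add: entry)
qed

lemma upper_triangular_pow_diag:
  fixes A :: "'a :: comm_ring_1 mat"
  assumes A: "A \<in> carrier_mat n n" and uA: "upper_triangular A"
  shows "upper_triangular (A ^\<^sub>m k) \<and> (\<forall>i<n. (A ^\<^sub>m k) $$ (i,i) = A $$ (i,i) ^ k)"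
proof (induction k)
  case (Suc k)
  then show ?case
    using upper_triangular_mult_diag[of "A ^\<^sub>m k" n A] A uA by (simp add: mult.commute)
qed (use A in simp)

text \<open>Telescoping gives each diagonal entry as the divided difference of t^k at a and s; the
  confluent case a = s is k s^(k - 1), stated with \<open>Suc m\<close> for k. These values decide
  whether the geometric sum is invertible.\<close>

lemma geom_sum_mat_diag:
  fixes A :: "'a :: comm_ring_1 mat"
  assumes A: "A \<in> carrier_mat n n" and uA: "upper_triangular A"
  shows "upper_triangular (geom_sum_mat A s k)"
    and "i < n \<Longrightarrow> (A $$ (i,i) - s) * geom_sum_mat A s k $$ (i,i) = A $$ (i,i) ^ k - s ^ k"
    and "i < n \<Longrightarrow> A $$ (i,i) = s \<Longrightarrow> geom_sum_mat A s (Suc m) $$ (i,i) = of_nat (Suc m) * s ^ m"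
proof -
  note carr = geom_sum_mat_carrier[OF A]
  note pow = upper_triangular_pow_diag[OF A uA]
  have step: "geom_sum_mat A s (Suc k) $$ (i,j) = (A ^\<^sub>m k) $$ (i,j) + s * geom_sum_mat A s k $$ (i,j)"
    if "i < n" "j < n" for i j k
    using carr[of s k] A that by simp
  show "upper_triangular (geom_sum_mat A s k)"
  proof (induction k)
    case (Suc k)
    show ?case
    proof (rule upper_triangularI)
      fix i j assume ij: "j < i" "i < dim_row (geom_sum_mat A s (Suc k))"
      then have n: "i < n" "j < n" using carr[of s "Suc k"] by auto
      show "geom_sum_mat A s (Suc k) $$ (i,j) = 0"
        unfolding step[OF n]
        using upper_triangularD[OF Suc, of j i] upper_triangularD[of "A ^\<^sub>m k" j i] pow[of k] ij n A carr[of s k]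
        by (simp add: upper_triangularD)
    qed
  qed (use A in simp)
  show "(A $$ (i,i) - s) * geom_sum_mat A s k $$ (i,i) = A $$ (i,i) ^ k - s ^ k" if i: "i < n"
  proof (induction k)
    case (Suc k)
    have "(A $$ (i,i) - s) * geom_sum_mat A s (Suc k) $$ (i,i)
       = (A $$ (i,i) - s) * A $$ (i,i) ^ k + s * ((A $$ (i,i) - s) * geom_sum_mat A s k $$ (i,i))"
      using i pow[of k] by (subst step) (simp_all add: algebra_simps)
    then show ?case by (simp only: Suc) (simp add: algebra_simps)
  qed (use A i in simp)
  show "geom_sum_mat A s (Suc m) $$ (i,i) = of_nat (Suc m) * s ^ m" if i: "i < n" "A $$ (i,i) = s"
  proof (induction m)
    case 0
    then show ?case using i pow[of 0] A by (simp add: step)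
  next
    case (Suc m)
    then show ?case
      using i pow[of "Suc m"] by (subst step) (simp_all add: algebra_simps)
  qed
qed

text \<open>The new column of the power depends linearly on \<open>w\<close>, so prescribing it
  amounts to solving a linear system with matrix \<open>geom_sum_mat A s k\<close>.\<close>

lemma pow_four_block_last_column:
  fixes A w :: "'a :: comm_ring_1 mat"
  assumes A: "A \<in> carrier_mat n n" and w: "w \<in> carrier_mat n 1"
  shows "four_block_mat A w (0\<^sub>m 1 n) (s \<cdot>\<^sub>m 1\<^sub>m 1) ^\<^sub>m k =
    four_block_mat (A ^\<^sub>m k) (geom_sum_mat A s k * w) (0\<^sub>m 1 n) (s ^ k \<cdot>\<^sub>m 1\<^sub>m 1)"
proof (induction k)
  case 0
  show ?case using A w by (intro eq_matI) auto
next
  case (Suc k)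
  note G = geom_sum_mat_carrier[OF A, of s k]
  have P: "A ^\<^sub>m k \<in> carrier_mat n n" using A by auto
  have s1: "(s ^ k \<cdot>\<^sub>m 1\<^sub>m 1) * (s \<cdot>\<^sub>m 1\<^sub>m 1) = (s ^ Suc k \<cdot>\<^sub>m 1\<^sub>m 1 :: 'a mat)"
    by (intro eq_matI) (auto simp: scalar_prod_def)
  have s2: "geom_sum_mat A s k * w * (s \<cdot>\<^sub>m 1\<^sub>m 1) = (s \<cdot>\<^sub>m geom_sum_mat A s k) * w"
    using G w by (intro eq_matI) (auto simp: scalar_prod_def sum_distrib_left sum_distrib_right algebra_simps)
  have s3: "A ^\<^sub>m k * w + geom_sum_mat A s k * w * (s \<cdot>\<^sub>m 1\<^sub>m 1) = geom_sum_mat A s (Suc k) * w"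
    unfolding s2 using P G w by (simp add: add_mult_distrib_mat[of _ n n])
  show ?case
    unfolding pow_mat.simps Suc
    apply (subst mult_four_block_mat[of _ n n _ 1 _ 1 _ _ n _ 1])
    using P G w A s3 s1 by (auto intro!: cong_four_block_mat)
qed

lemma upper_triangular_imp_inverse:
  fixes G :: "'a :: field mat"
  assumes G: "G \<in> carrier_mat n n" and "upper_triangular G" and "\<And>i. i < n \<Longrightarrow> G $$ (i,i) \<noteq> 0"
  obtains G' where "G' \<in> carrier_mat n n" and "G * G' = 1\<^sub>m n" and "G' * G = 1\<^sub>m n"
proof -
  have "det G \<noteq> 0"
    using det_upper_triangular[OF assms(2) G] assms(3) G by (auto simp: prod_list_zero_iff diag_mat_def)
  then have "G \<in> Units (ring_mat TYPE('a) n ())" by (rule det_non_zero_imp_unit[OF G])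
  then show thesis using that unfolding Units_def ring_mat_def by auto
qed

text \<open>The roots of the diagonal entries must be chosen as a function \<open>r\<close> of the entry: distinct
  roots of the same value would make a geometric sum on the diagonal vanish.\<close>

lemma upper_triangular_has_kth_root:
  fixes U :: "'a :: field mat"
  assumes "U \<in> carrier_mat n n" and "upper_triangular U"
    and "\<And>i. i < n \<Longrightarrow> r (U $$ (i,i)) ^ k = U $$ (i,i)"
    and "\<And>i j. i < j \<Longrightarrow> j < n \<Longrightarrow> U $$ (i,i) \<noteq> 0 \<or> U $$ (j,j) \<noteq> 0"
    and k: "of_nat k \<noteq> (0 :: 'a)"
  shows "\<exists>A \<in> carrier_mat n n. upper_triangular A \<and> (\<forall>i<n. A $$ (i,i) = r (U $$ (i,i))) \<and> A ^\<^sub>m k = U"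
  using assms(1-4)
proof (induction n arbitrary: U)
  case 0
  then show ?case by (intro bexI[of _ "0\<^sub>m 0 0"]) auto
next
  case (Suc n)
  obtain m where m: "k = Suc m" using k by (cases k) auto
  obtain U1 u c d where split: "split_block U n n = (U1, u, c, d)" by (metis prod_cases4)
  note sb = split_block[OF split, of 1 1]
  have U1: "U1 \<in> carrier_mat n n" and u: "u \<in> carrier_mat n 1" and c: "c \<in> carrier_mat 1 n"
    and d: "d \<in> carrier_mat 1 1" and U: "U = four_block_mat U1 u c d"
    using sb Suc.prems(1) by auto
  have ent: "U $$ (i,j) = U1 $$ (i,j)" if "i < n" "j < n" for i j using U U1 d that by simp
  have c0: "c = 0\<^sub>m 1 n"
  proof (intro eq_matI)
    fix i j assume "i < dim_row (0\<^sub>m 1 n :: 'a mat)" "j < dim_col (0\<^sub>m 1 n :: 'a mat)"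
    moreover from this have "U $$ (n, j) = 0"
      using Suc.prems(1) upper_triangularD[OF Suc.prems(2), of j n] by auto
    ultimately show "c $$ (i,j) = 0\<^sub>m 1 n $$ (i,j)" using U U1 c d by auto
  qed (use c in auto)
  define s where "s = r (U $$ (n,n))"
  have sk: "s ^ k = U $$ (n,n)" unfolding s_def by (rule Suc.prems) simp
  have dd: "d = s ^ k \<cdot>\<^sub>m 1\<^sub>m 1"
    unfolding sk using U U1 d by (intro eq_matI) auto
  have "\<exists>A \<in> carrier_mat n n. upper_triangular A \<and> (\<forall>i<n. A $$ (i,i) = r (U1 $$ (i,i))) \<and> A ^\<^sub>m k = U1"
  proof (rule Suc.IH[OF U1])
    show "upper_triangular U1"
      using ent[symmetric] U1 Suc.prems(1) upper_triangularD[OF Suc.prems(2)]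
      by (intro upper_triangularI) auto
    show "r (U1 $$ (i, i)) ^ k = U1 $$ (i, i)" if "i < n" for i
      using Suc.prems(3)[of i] ent[of i i] that by simp
    show "U1 $$ (i, i) \<noteq> 0 \<or> U1 $$ (j, j) \<noteq> 0" if "i < j" "j < n" for i j
      using Suc.prems(4)[of i j] ent[of i i] ent[of j j] that by simp
  qed
  then obtain A where A: "A \<in> carrier_mat n n" "upper_triangular A" "A ^\<^sub>m k = U1"
    and Ad: "\<And>i. i < n \<Longrightarrow> A $$ (i,i) = r (U $$ (i,i))" using ent by auto
  note G = geom_sum_mat_carrier[OF A(1), of s k]
  \<comment> \<open>If the two roots differ, so do their k-th powers, because \<open>r\<close> is a
    function; if they agree, the entry is k s^(k - 1).\<close>
  have "geom_sum_mat A s k $$ (i,i) \<noteq> 0" if i: "i < n" for i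
  proof (cases "A $$ (i,i) = s")
    case True
    \<comment> \<open>Here \<open>s = 0\<close> would force zeros on the diagonal of
      \<open>U\<close> at both \<open>i\<close> and \<open>n\<close>.\<close>
    have "s \<noteq> 0"
      using Suc.prems(4)[of i n] Suc.prems(3)[of i] sk i Ad[OF i] True by (auto simp: m)
    then show ?thesis
      using geom_sum_mat_diag(3)[OF A(1,2) i True, of m] k by (simp add: m)
  next
    case False
    have "A $$ (i,i) ^ k \<noteq> s ^ k"
      using False Suc.prems(3)[of i] sk i Ad[OF i] unfolding s_def by auto
    then show ?thesis
      using geom_sum_mat_diag(2)[OF A(1,2) i, of s k] by auto
  qed
  then obtain G' where G': "G' \<in> carrier_mat n n" "geom_sum_mat A s k * G' = 1\<^sub>m n"
    using upper_triangular_imp_inverse[OF G geom_sum_mat_diag(1)[OF A(1,2)]] by blast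
  define w where "w = G' * u"
  have w: "w \<in> carrier_mat n 1" using G' u by (auto simp: w_def)
  have Gw: "geom_sum_mat A s k * w = u"
    unfolding w_def using G G' u by (simp flip: assoc_mult_mat[OF G G'(1) u])
  define B where "B = four_block_mat A w (0\<^sub>m 1 n) (s \<cdot>\<^sub>m 1\<^sub>m 1)"
  have Bk: "B ^\<^sub>m k = U"
    unfolding B_def pow_four_block_last_column[OF A(1) w] U Gw A c0 dd ..
  have Bc: "B \<in> carrier_mat (Suc n) (Suc n)"
    using four_block_carrier_mat[OF A(1), of "s \<cdot>\<^sub>m 1\<^sub>m 1" 1 1] by (simp add: B_def)
  moreover have "upper_triangular B"
    using A by (intro upper_triangularI) (auto simp: B_def upper_triangularD)
  moreover have "B $$ (i,i) = r (U $$ (i,i))" if "i < Suc n" for i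
    using that A(1) Ad by (cases "i = n") (auto simp: B_def s_def)
  ultimately show ?case using Bk by blast
qed

section \<open>Prescribing the diagonal\<close>

definition mat_trace :: "'a :: comm_ring_1 mat \<Rightarrow> 'a" where
  "mat_trace A = (\<Sum>i<dim_row A. A $$ (i,i))"

lemma mat_trace_mult_commute:
  fixes A B :: "'a :: comm_ring_1 mat"
  assumes A: "A \<in> carrier_mat n m" and B: "B \<in> carrier_mat m n"
  shows "mat_trace (A * B) = mat_trace (B * A)"
proof -
  have "mat_trace (A * B) = (\<Sum>i<n. \<Sum>j<m. A $$ (i,j) * B $$ (j,i))"
    using A B by (auto simp: mat_trace_def scalar_prod_def lessThan_atLeast0 intro!: sum.cong)
  also have "\<dots> = (\<Sum>j<m. \<Sum>i<n. B $$ (j,i) * A $$ (i,j))"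
    by (subst sum.swap) (simp add: mult.commute)
  also have "\<dots> = mat_trace (B * A)"
    using A B by (auto simp: mat_trace_def scalar_prod_def lessThan_atLeast0 intro!: sum.cong)
  finally show ?thesis .
qed

lemma mat_trace_similar:
  fixes A B :: "'a :: comm_ring_1 mat"
  assumes "similar_mat A B"
  shows "mat_trace A = mat_trace B"
proof -
  from similar_matD[OF assms] obtain n P Q where
    c: "A \<in> carrier_mat n n" "B \<in> carrier_mat n n" "P \<in> carrier_mat n n" "Q \<in> carrier_mat n n"
    and e: "Q * P = 1\<^sub>m n" "A = P * B * Q" by auto
  have "mat_trace A = mat_trace (Q * (P * B))"
    unfolding e using mat_trace_mult_commute[of "P * B" n n Q] c by simp
  also have "Q * (P * B) = B" using c e by (simp flip: assoc_mult_mat[of Q n n P n B n])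
  finally show ?thesis .
qed

lemma mat_trace_four_block:
  assumes "A \<in> carrier_mat 1 1" and "D \<in> carrier_mat m m"
  shows "mat_trace (four_block_mat A B C D) = A $$ (0,0) + mat_trace D"
proof -
  have "mat_trace (four_block_mat A B C D) = (\<Sum>i<Suc m. four_block_mat A B C D $$ (i,i))"
    using assms by (simp add: mat_trace_def)
  also have "\<dots> = four_block_mat A B C D $$ (0,0) + (\<Sum>i<m. four_block_mat A B C D $$ (Suc i,Suc i))"
    by (rule sum.lessThan_Suc_shift)
  also have "\<dots> = A $$ (0,0) + mat_trace D"
    using assms by (auto simp: mat_trace_def intro!: sum.cong)
  finally show ?thesis .
qed

definition scalar_mat :: "nat \<Rightarrow> 'a :: comm_ring_1 mat \<Rightarrow> bool" where
  "scalar_mat n A \<longleftrightarrow> (\<exists>c. A = c \<cdot>\<^sub>m 1\<^sub>m n)"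

lemma similar_mat_transpose:
  fixes A B :: "'a :: comm_ring_1 mat"
  assumes "similar_mat A B"
  shows "similar_mat (transpose_mat A) (transpose_mat B)"
proof -
  from similar_matD[OF assms] obtain n P Q where
    c: "A \<in> carrier_mat n n" "B \<in> carrier_mat n n" "P \<in> carrier_mat n n" "Q \<in> carrier_mat n n"
    and e: "P * Q = 1\<^sub>m n" "Q * P = 1\<^sub>m n" "A = P * B * Q" by auto
  show ?thesis
  proof (rule similar_matI[of _ _ "transpose_mat Q" "transpose_mat P" n])
    show "transpose_mat Q * transpose_mat P = 1\<^sub>m n"
      using c e(1) by (metis transpose_mult transpose_one)
    show "transpose_mat P * transpose_mat Q = 1\<^sub>m n"
      using c e(2) by (metis transpose_mult transpose_one)
    show "transpose_mat A = transpose_mat Q * transpose_mat B * transpose_mat P"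
    proof -
      have "transpose_mat A = transpose_mat Q * transpose_mat (P * B)"
        unfolding e(3) using transpose_mult[of "P * B" n n Q n] c by simp
      also have "transpose_mat (P * B) = transpose_mat B * transpose_mat P"
        using transpose_mult[of P n n B n] c by simp
      finally show ?thesis using c by (simp add: assoc_mult_mat[of _ n n _ n _ n])
    qed
  qed (use c in auto)
qed

text \<open>Conjugation by a unipotent matrix with row \<open>x\<close> keeps the column
  \<open>c\<close>, moves the corner by \<open>- x * c\<close> and adds \<open>c * x\<close> to the
  lower block. A nonzero \<open>c\<close> thus makes the corner arbitrary.\<close>

lemma similar_mat_row_shear:
  fixes a r c B x :: "'a :: comm_ring_1 mat"
  assumes car: "a \<in> carrier_mat 1 1" "r \<in> carrier_mat 1 m" "c \<in> carrier_mat m 1" "B \<in> carrier_mat m m"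
    and x: "x \<in> carrier_mat 1 m"
  shows "\<exists>s \<in> carrier_mat 1 m.
    similar_mat (four_block_mat a r c B) (four_block_mat (a + - x * c) s c (c * x + B))"
proof -
  define P where "P = four_block_mat (1\<^sub>m 1) x (0\<^sub>m m 1) (1\<^sub>m m)"
  define Q where "Q = four_block_mat (1\<^sub>m 1) (-x) (0\<^sub>m m 1) (1\<^sub>m m)"
  have PQ: "P * Q = 1\<^sub>m (1 + m)"
    unfolding P_def Q_def using x
    by (subst mult_four_block_mat[of _ 1 1 _ m _ m _ _ 1 _ m], simp_all, intro eq_matI, auto)
  have QP: "Q * P = 1\<^sub>m (1 + m)"
    unfolding P_def Q_def using x
    by (subst mult_four_block_mat[of _ 1 1 _ m _ m _ _ 1 _ m], simp_all, intro eq_matI, auto)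
  define s where "s = (a * x + r) + - x * (c * x + B)"
  have s: "s \<in> carrier_mat 1 m" using car x by (auto simp: s_def)
  have MP: "four_block_mat a r c B * P = four_block_mat a (a * x + r) c (c * x + B)"
    unfolding P_def using car x
    by (subst mult_four_block_mat[of _ 1 1 _ m _ m _ _ 1 _ m]) (auto intro!: cong_four_block_mat)
  have QMP: "Q * (four_block_mat a r c B * P) = four_block_mat (a + - x * c) s c (c * x + B)"
    unfolding MP unfolding Q_def s_def using car x
    by (subst mult_four_block_mat[of _ 1 1 _ m _ m _ _ 1 _ m]) (auto intro!: cong_four_block_mat)
  have cP: "P \<in> carrier_mat (1+m) (1+m)" "Q \<in> carrier_mat (1+m) (1+m)"
    unfolding P_def Q_def by (intro four_block_carrier_mat; simp)+
  have cM: "four_block_mat a r c B \<in> carrier_mat (1+m) (1+m)" using car by (intro four_block_carrier_mat)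
  have "similar_mat (four_block_mat (a + - x * c) s c (c * x + B)) (four_block_mat a r c B)"
  proof (rule similar_matI[OF _ QP PQ])
    show "four_block_mat (a + - x * c) s c (c * x + B) = Q * four_block_mat a r c B * P"
      using QMP cP cM by (simp add: assoc_mult_mat[of Q "1+m" "1+m" _ "1+m" P "1+m"])
    show "{four_block_mat (a + - x * c) s c (c * x + B), four_block_mat a r c B, Q, P} \<subseteq> carrier_mat (1 + m) (1 + m)"
      using cP cM car x QMP by (metis empty_subsetI insert_subset mult_carrier_mat)
  qed
  then show ?thesis using s similar_mat_sym by blast
qed

text \<open>Supplies the missing nonzero column when both off-diagonal blocks vanish.\<close>

lemma similar_mat_column_shear_diag:
  fixes a B y :: "'a :: comm_ring_1 mat"
  assumes car: "a \<in> carrier_mat 1 1" "B \<in> carrier_mat m m"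
    and y: "y \<in> carrier_mat m 1"
  shows "similar_mat (four_block_mat a (0\<^sub>m 1 m) (0\<^sub>m m 1) B) (four_block_mat a (0\<^sub>m 1 m) (- y * a + B * y) B)"
proof -
  define P where "P = four_block_mat (1\<^sub>m 1) (0\<^sub>m 1 m) y (1\<^sub>m m)"
  define Q where "Q = four_block_mat (1\<^sub>m 1) (0\<^sub>m 1 m) (-y) (1\<^sub>m m)"
  let ?M = "four_block_mat a (0\<^sub>m 1 m) (0\<^sub>m m 1) B"
  let ?N = "four_block_mat a (0\<^sub>m 1 m) (- y * a + B * y) B"
  have PQ: "P * Q = 1\<^sub>m (1 + m)"
    unfolding P_def Q_def using y
    by (subst mult_four_block_mat[of _ 1 1 _ m _ m _ _ 1 _ m], simp_all, intro eq_matI, auto)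
  have QP: "Q * P = 1\<^sub>m (1 + m)"
    unfolding P_def Q_def using y
    by (subst mult_four_block_mat[of _ 1 1 _ m _ m _ _ 1 _ m]) simp_all
  have MP: "?M * P = four_block_mat a (0\<^sub>m 1 m) (B * y) B"
    unfolding P_def using car y
    by (subst mult_four_block_mat[of _ 1 1 _ m _ m _ _ 1 _ m]) (auto intro!: cong_four_block_mat)
  have QMP: "Q * (?M * P) = ?N"
    unfolding MP unfolding Q_def using car y
    by (subst mult_four_block_mat[of _ 1 1 _ m _ m _ _ 1 _ m]) (auto intro!: cong_four_block_mat)
  have cP: "P \<in> carrier_mat (1+m) (1+m)" "Q \<in> carrier_mat (1+m) (1+m)"
    unfolding P_def Q_def by (intro four_block_carrier_mat; simp)+
  have cM: "?M \<in> carrier_mat (1+m) (1+m)" using car by (intro four_block_carrier_mat)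
  have "similar_mat ?N ?M"
  proof (rule similar_matI[OF _ QP PQ])
    show "?N = Q * ?M * P"
      using QMP cP cM by (simp add: assoc_mult_mat[of Q "1+m" "1+m" _ "1+m" P "1+m"])
    show "{?N, ?M, Q, P} \<subseteq> carrier_mat (1 + m) (1 + m)"
      using cP cM car y QMP by (metis empty_subsetI insert_subset mult_carrier_mat)
  qed
  then show ?thesis by (rule similar_mat_sym)
qed

text \<open>The row \<open>x\<close> may be changed by a nonzero row annihilating \<open>c\<close>, and this destroys scalarity.\<close>

lemma exists_row_nonscalar_update:
  fixes c B :: "'a :: field mat"
  assumes c: "c \<in> carrier_mat m 1" "c \<noteq> 0\<^sub>m m 1" and B: "B \<in> carrier_mat m m"
  shows "\<exists>x \<in> carrier_mat 1 m. (x * c) $$ (0,0) = t \<and> (m = 1 \<or> \<not> scalar_mat m (c * x + B))"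
proof -
  obtain j where j: "j < m" "c $$ (j,0) \<noteq> 0"
  proof (rule ccontr)
    assume "\<not> thesis"
    then have "c = 0\<^sub>m m 1" using c(1) that by (intro eq_matI) auto
    then show False using c by simp
  qed
  define x0 where "x0 = mat 1 m (\<lambda>(_,l). if l = j then t / c $$ (j,0) else 0)"
  have x0: "x0 \<in> carrier_mat 1 m" by (simp add: x0_def)
  have dot: "(x * c) $$ (0,0) = (\<Sum>l<m. x $$ (0,l) * c $$ (l,0))" if "x \<in> carrier_mat 1 m" for x
    using that c by (simp add: scalar_prod_def lessThan_atLeast0)
  have x0c: "(x0 * c) $$ (0,0) = t"
    unfolding dot[OF x0] using j by (simp add: x0_def if_distrib[of "\<lambda>u. u * _"] sum.delta cong: if_cong)
  show ?thesis
  proof (cases "m = 1 \<or> \<not> scalar_mat m (c * x0 + B)")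
    case True
    then show ?thesis using x0 x0c by blast
  next
    case False
    then obtain b where b: "c * x0 + B = b \<cdot>\<^sub>m 1\<^sub>m m" and m: "m \<noteq> 1" by (auto simp: scalar_mat_def)
    obtain i where i: "i < m" "i \<noteq> j" using m j(1) that[of 0] that[of 1] by (cases "j = 0") auto
    \<comment> \<open>Chosen orthogonal to \<open>c\<close>, yet with the nonzero entry
      \<open>c $$ (j,0)\<close> at position \<open>i\<close>.\<close>
    define z where "z = mat 1 m (\<lambda>(_,l). if l = i then c $$ (j,0) else if l = j then - c $$ (i,0) else 0)"
    have z: "z \<in> carrier_mat 1 m" by (simp add: z_def)
    have "(z * c) $$ (0,0) = (\<Sum>l\<in>{i,j}. z $$ (0,l) * c $$ (l,0))"
      unfolding dot[OF z] by (rule sum.mono_neutral_right) (use i j in \<open>auto simp: z_def\<close>)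
    also have "\<dots> = 0" using i j by (simp add: z_def)
    finally have zc: "(z * c) $$ (0,0) = 0" .
    have x0z: "x0 + z \<in> carrier_mat 1 m" using x0 z by simp
    have 1: "((x0 + z) * c) $$ (0,0) = t"
      using x0 z c x0c zc by (simp add: add_mult_distrib_mat[OF x0 z c(1)])
    have "\<not> scalar_mat m (c * (x0 + z) + B)"
    proof
      assume "scalar_mat m (c * (x0 + z) + B)"
      then obtain b' where b': "c * (x0 + z) + B = b' \<cdot>\<^sub>m 1\<^sub>m m" by (auto simp: scalar_mat_def)
      have entry: "(b' \<cdot>\<^sub>m 1\<^sub>m m) $$ (u,v) = (b \<cdot>\<^sub>m 1\<^sub>m m) $$ (u,v) + c $$ (u,0) * z $$ (0,v)"
        if "u < m" "v < m" for u v
        unfolding b[symmetric] b'[symmetric] using that x0 z c B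
        by (simp add: scalar_prod_def algebra_simps)
      \<comment> \<open>Both matrices are scalar, so their entries at the off-diagonal position
        \<open>(j,i)\<close> vanish; but they differ there by the square of
        \<open>c $$ (j,0)\<close>.\<close>
      have ji: "c $$ (j,0) * z $$ (0,i) = 0" using entry[OF j(1) i(1)] i j by simp
      then show False using i j by (simp add: z_def)
    qed
    then show ?thesis using 1 x0z by blast
  qed
qed

text \<open>Nonscalarity of \<open>D\<close> is carried along so that the induction on the size can
  continue; a block of size 1 is always scalar, but there the trace fixes its only entry.\<close>

lemma similar_mat_prescribed_corner:
  fixes a r c B :: "'a :: field mat"
  assumes car: "a \<in> carrier_mat 1 1" "r \<in> carrier_mat 1 m" "c \<in> carrier_mat m 1" "B \<in> carrier_mat m m"
    and c: "c \<noteq> 0\<^sub>m m 1"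
  shows "\<exists>s \<in> carrier_mat 1 m. \<exists>D \<in> carrier_mat m m.
    similar_mat (four_block_mat a r c B) (four_block_mat (t \<cdot>\<^sub>m 1\<^sub>m 1) s c D) \<and> (m = 1 \<or> \<not> scalar_mat m D)"
proof -
  obtain x where x: "x \<in> carrier_mat 1 m" "(x * c) $$ (0,0) = a $$ (0,0) - t"
    "m = 1 \<or> \<not> scalar_mat m (c * x + B)"
    using exists_row_nonscalar_update[OF car(3) c car(4)] by blast
  obtain s where s: "s \<in> carrier_mat 1 m"
    "similar_mat (four_block_mat a r c B) (four_block_mat (a + - x * c) s c (c * x + B))"
    using similar_mat_row_shear[OF car x(1)] by blast
  have "a + - x * c = t \<cdot>\<^sub>m 1\<^sub>m 1"
    using car x by (intro eq_matI) (auto simp: uminus_scalar_prod)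
  then show ?thesis using s x car by (intro bexI[of _ s] bexI[of _ "c * x + B"]) auto
qed

text \<open>This is due to Fillmore.\<close>

theorem nonscalar_similar_prescribed_diagonal:
  fixes M :: "'a :: field mat"
  assumes "M \<in> carrier_mat n n" and "n = 1 \<or> \<not> scalar_mat n M" and "(\<Sum>i<n. c i) = mat_trace M"
  shows "\<exists>D \<in> carrier_mat n n. similar_mat M D \<and> (\<forall>i<n. D $$ (i,i) = c i)"
  using assms
proof (induction n arbitrary: M c)
  case 0
  then show ?case by (intro bexI[of _ M]) (auto intro: similar_mat_refl)
next
  case (Suc m)
  note M = Suc.prems(1)
  show ?case
  proof (cases "m = 0")
    case True
    then show ?thesis using Suc.prems by (intro bexI[of _ M]) (auto simp: mat_trace_def similar_mat_refl)
  next
    case False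
    then have nonscalar: "\<not> scalar_mat (Suc m) M" using Suc.prems by simp
    \<comment> \<open>The case of a nonzero column under the corner. A nonzero row is reduced to it
      by transposing, and a block-diagonal matrix by a column shear.\<close>
    have step: "\<exists>D \<in> carrier_mat (Suc m) (Suc m). similar_mat N D \<and> (\<forall>i<Suc m. D $$ (i,i) = c i)"
      if N: "N = four_block_mat a r e B" and tr: "mat_trace N = (\<Sum>i<Suc m. c i)"
        and car: "a \<in> carrier_mat 1 1" "r \<in> carrier_mat 1 m" "e \<in> carrier_mat m 1" "B \<in> carrier_mat m m"
        and e: "e \<noteq> 0\<^sub>m m 1" for N a r e B
    proof -
      obtain s D where s: "s \<in> carrier_mat 1 m" and D: "D \<in> carrier_mat m m"
        and sim: "similar_mat N (four_block_mat (c 0 \<cdot>\<^sub>m 1\<^sub>m 1) s e D)" and nsc: "m = 1 \<or> \<not> scalar_mat m D"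
        using similar_mat_prescribed_corner[OF car e, of "c 0"] N by blast
      have "(\<Sum>i<m. c (Suc i)) = mat_trace D"
        using mat_trace_similar[OF sim] tr D mat_trace_four_block[of "c 0 \<cdot>\<^sub>m 1\<^sub>m 1" D m s e]
        by (simp add: sum.lessThan_Suc_shift del: sum.lessThan_Suc)
      then obtain D' where D': "D' \<in> carrier_mat m m" "similar_mat D D'"
        and diag: "\<And>i. i < m \<Longrightarrow> D' $$ (i,i) = c (Suc i)"
        using Suc.IH[OF D nsc, of "\<lambda>i. c (Suc i)"] by blast
      then obtain P Q where PQ: "similar_mat_wit D D' P Q" unfolding similar_mat_def by blast
      note w = similar_mat_witD2[OF D PQ]
      let ?u = "c 0 \<cdot>\<^sub>m 1\<^sub>m 1"
      have "similar_mat_wit (four_block_mat ?u s e D) (four_block_mat ?u (s * P) (Q * e) D')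
         (four_block_mat (1\<^sub>m 1) (0\<^sub>m 1 m) (0\<^sub>m m 1) P) (four_block_mat (1\<^sub>m 1) (0\<^sub>m 1 m) (0\<^sub>m m 1) Q)"
      proof (rule similar_mat_wit_four_block[OF similar_mat_wit_refl PQ])
        show "?u \<in> carrier_mat 1 1" by simp
        show "s = 1\<^sub>m 1 * (s * P) * Q"
          using s w by (simp add: assoc_mult_mat[of s 1 m P m Q m])
        show "e = P * (Q * e) * 1\<^sub>m 1"
          using car w by (simp flip: assoc_mult_mat[of P m m Q m e 1])
      qed (use s D car w in auto)
      then have "similar_mat N (four_block_mat ?u (s * P) (Q * e) D')"
        using sim similar_mat_trans unfolding similar_mat_def by blast
      moreover have "four_block_mat ?u (s * P) (Q * e) D' \<in> carrier_mat (Suc m) (Suc m)"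
        using four_block_carrier_mat[of ?u 1 1 D' m m] D' by simp
      moreover have "four_block_mat ?u (s * P) (Q * e) D' $$ (i,i) = c i" if "i < Suc m" for i
        using that D' diag by (cases i) auto
      ultimately show ?thesis by blast
    qed
    obtain a r e B where split: "split_block M 1 1 = (a, r, e, B)" by (metis prod_cases4)
    note sb = split_block[OF split, of m m]
    have car: "a \<in> carrier_mat 1 1" "r \<in> carrier_mat 1 m" "e \<in> carrier_mat m 1" "B \<in> carrier_mat m m"
      and Mb: "M = four_block_mat a r e B"
      using sb M by auto
    consider "e \<noteq> 0\<^sub>m m 1" | "r \<noteq> 0\<^sub>m 1 m" | "e = 0\<^sub>m m 1" "r = 0\<^sub>m 1 m" by blast
    then show ?thesis
    proof cases
      case 1
      then show ?thesis using step[OF Mb Suc.prems(3)[symmetric] car] by blast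
    next
      case 2
      have tr: "mat_trace (transpose_mat M) = (\<Sum>i<Suc m. c i)"
        using Suc.prems(3) M by (simp add: mat_trace_def)
      have "transpose_mat r \<noteq> 0\<^sub>m m 1" using 2 by (metis Matrix.transpose_transpose zero_transpose_mat)
      then obtain D where D: "D \<in> carrier_mat (Suc m) (Suc m)" "similar_mat (transpose_mat M) D"
        "\<forall>i<Suc m. D $$ (i,i) = c i"
        using step[OF _ tr, of "transpose_mat a" "transpose_mat e" "transpose_mat r" "transpose_mat B"]
          transpose_four_block_mat[OF car] Mb car by auto
      then show ?thesis
        using similar_mat_transpose[OF D(2)] by (intro bexI[of _ "transpose_mat D"]) auto
    next
      case 3
      \<comment> \<open>Otherwise testing with unit columns shows that \<open>B\<close> is scalar
        with the corner as its eigenvalue, so that \<open>M\<close> would be scalar.\<close>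
      have "\<exists>y \<in> carrier_mat m 1. - y * a + B * y \<noteq> 0\<^sub>m m 1"
      proof (rule ccontr)
        assume *: "\<not> ?thesis"
        have "B $$ (i,j) = (if i = j then a $$ (0,0) else 0)" if ij: "i < m" "j < m" for i j
        proof -
          define y where "y = mat m 1 (\<lambda>(u,_). if u = j then 1 else 0 :: 'a)"
          have y: "y \<in> carrier_mat m 1" by (simp add: y_def)
          have "(- y * a + B * y) $$ (i,0) = 0" using * y ij by auto
          moreover have "(B * y) $$ (i,0) = B $$ (i,j)"
            using ij car by (simp add: scalar_prod_def y_def if_distrib[of "\<lambda>u. _ * u"] sum.delta cong: if_cong)
          moreover have "(- y * a) $$ (i,0) = - (y $$ (i,0) * a $$ (0,0))"
            using ij car y by (simp add: scalar_prod_def)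
          moreover have "y $$ (i,0) = (if i = j then 1 else 0)" using ij by (simp add: y_def)
          ultimately show ?thesis using ij car y by (auto split: if_splits)
        qed
        then have "M = a $$ (0,0) \<cdot>\<^sub>m 1\<^sub>m (Suc m)"
          using Mb 3 car M by (intro eq_matI) auto
        then show False using nonscalar by (auto simp: scalar_mat_def)
      qed
      then obtain y where y: "y \<in> carrier_mat m 1" "- y * a + B * y \<noteq> 0\<^sub>m m 1" by blast
      note sim = similar_mat_column_shear_diag[OF car(1,4) y(1)]
      let ?N = "four_block_mat a (0\<^sub>m 1 m) (- y * a + B * y) B"
      have MN: "similar_mat M ?N" using sim Mb 3 by simp
      have "\<exists>D \<in> carrier_mat (Suc m) (Suc m). similar_mat ?N D \<and> (\<forall>i<Suc m. D $$ (i,i) = c i)"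
        by (rule step[OF refl]) (use mat_trace_similar[OF MN] Suc.prems(3) car y in auto)
      then show ?thesis using MN similar_mat_trans by blast
    qed
  qed
qed

section \<open>Sums over large multiplicative subgroups\<close>

text \<open>Cauchy-Schwarz for the fibre sizes of \<open>f\<close>: their sum is
  \<open>card A\<close>, and the sum of their squares counts the colliding pairs.\<close>

lemma card_power2_le_image_times_collisions:
  assumes "finite A"
  shows "(card A)\<^sup>2 \<le> card (f ` A) * (\<Sum>x\<in>A. \<Sum>y\<in>A. of_bool (f x = f y))"
proof -
  define r where "r z = card {x \<in> A. f x = z}" for z
  have A: "card A = (\<Sum>z\<in>f ` A. r z)"
    unfolding r_def using sum.image_gen[OF assms, of "\<lambda>_. 1 :: nat" f] by simp
  have "(\<Sum>x\<in>A. \<Sum>y\<in>A. of_bool (f x = f y)) = (\<Sum>x\<in>A. r (f x))"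
    using assms by (intro sum.cong) (auto simp: r_def of_bool_def sum.If_cases Int_def eq_commute intro!: arg_cong[where f = card])
  also have "\<dots> = (\<Sum>z\<in>f ` A. \<Sum>x\<in>{x \<in> A. f x = z}. r (f x))"
    by (rule sum.image_gen[OF assms])
  also have "\<dots> = (\<Sum>z\<in>f ` A. (r z)\<^sup>2)"
    by (intro sum.cong) (auto simp: r_def power2_eq_square)
  finally have B: "(\<Sum>x\<in>A. \<Sum>y\<in>A. of_bool (f x = f y)) = (\<Sum>z\<in>f ` A. (r z)\<^sup>2)" .
  have "(\<Sum>z\<in>f ` A. real (r z))\<^sup>2 \<le> (\<Sum>z\<in>f ` A. (real (r z))\<^sup>2) * real (card (f ` A))"
    by (rule sum_squared_le_sum_of_squares)
  then have "real ((card A)\<^sup>2) \<le> real (card (f ` A) * (\<Sum>z\<in>f ` A. (r z)\<^sup>2))"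
    by (simp add: A mult.commute)
  then show ?thesis unfolding B of_nat_le_iff .
qed

lemma card_sum_gt_imp_Int_nonempty:
  fixes A B :: "'a :: finite set"
  assumes "CARD('a) < card A + card B"
  shows "A \<inter> B \<noteq> {}"
proof
  assume "A \<inter> B = {}"
  then have "card A + card B = card (A \<union> B)" by (simp add: card_Un_disjoint)
  also have "\<dots> \<le> CARD('a)" by (rule card_mono) auto
  finally show False using assms by simp
qed

text \<open>Averaging over the q - 1 nonzero \<xi>: two distinct points collide for at most one
  \<xi>, and only when both coordinates differ. With h = \<open>card H\<close>, the threshold 2 h^4
  / q is the one for which Cauchy-Schwarz makes H + \<xi> H larger than q / 2.\<close>

lemma large_set_exists_dilate_collision_bound:
  fixes H :: "'a :: {field, finite} set"
  assumes big: "CARD('a) < (card H)\<^sup>2" and two: "2 \<le> card H"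
  shows "\<exists>\<xi>. \<xi> \<noteq> 0 \<and> CARD('a) * (\<Sum>x\<in>H \<times> H. \<Sum>y\<in>H \<times> H.
    of_bool (fst x + \<xi> * snd x = fst y + \<xi> * snd y)) < 2 * card H ^ 4"
proof (rule ccontr)
  define h where "h = card H"
  define q where "q = CARD('a)"
  let ?E = "\<lambda>\<xi>. \<Sum>x\<in>H \<times> H. \<Sum>y\<in>H \<times> H. of_bool (fst x + \<xi> * snd x = fst y + \<xi> * snd y) :: nat"
  assume "\<not> ?thesis"
  then have all: "2 * h ^ 4 \<le> q * ?E \<xi>" if "\<xi> \<noteq> 0" for \<xi>
    using that by (force simp: h_def q_def not_less)
  have q1: "card (UNIV - {0 :: 'a}) = q - 1" by (simp add: q_def card_Diff_singleton)
  have inner: "(\<Sum>\<xi>\<in>UNIV - {0}. of_bool (fst x + \<xi> * snd x = fst y + \<xi> * snd y))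
      \<le> of_bool (x = y) * (q - 1) + of_bool (fst x \<noteq> fst y \<and> snd x \<noteq> snd y)" for x y :: "'a \<times> 'a"
  proof (cases "x = y")
    case True
    then show ?thesis using q1 by simp
  next
    case False
    let ?S = "{\<xi> \<in> UNIV - {0}. fst x + \<xi> * snd x = fst y + \<xi> * snd y}"
    have sum: "(\<Sum>\<xi>\<in>UNIV - {0}. of_bool (fst x + \<xi> * snd x = fst y + \<xi> * snd y)) = card ?S"
      by (simp add: of_bool_def sum.If_cases Int_def)
    have sub: "\<xi> = (fst x - fst y) / (snd y - snd x) \<and> fst x \<noteq> fst y \<and> snd x \<noteq> snd y" if "\<xi> \<in> ?S" for \<xi>
    proof -
      have e: "\<xi> * (snd y - snd x) = fst x - fst y" and "\<xi> \<noteq> 0"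
        using that by (auto simp: algebra_simps)
      have "snd x \<noteq> snd y" using e False by (metis diff_self mult_zero_right prod_eqI right_minus_eq)
      then show ?thesis using e \<open>\<xi> \<noteq> 0\<close> by (auto simp: field_simps)
    qed
    show ?thesis
    proof (cases "fst x \<noteq> fst y \<and> snd x \<noteq> snd y")
      case True
      have "card ?S \<le> card {(fst x - fst y) / (snd y - snd x)}"
        using sub by (intro card_mono) auto
      then show ?thesis using True unfolding sum by simp
    next
      case False
      then have "?S = {}" using sub by blast
      then show ?thesis unfolding sum by (metis card.empty le0)
    qed
  qed
  have "(q - 1) * (2 * h ^ 4) = (\<Sum>\<xi>\<in>UNIV - {0 :: 'a}. 2 * h ^ 4)" using q1 by simp
  also have "\<dots> \<le> (\<Sum>\<xi>\<in>UNIV - {0}. q * ?E \<xi>)" by (intro sum_mono) (use all in auto)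
  also have "\<dots> = q * (\<Sum>\<xi>\<in>UNIV - {0}. ?E \<xi>)" by (simp add: sum_distrib_left)
  also have "(\<Sum>\<xi>\<in>UNIV - {0}. ?E \<xi>) = (\<Sum>x\<in>H \<times> H. \<Sum>y\<in>H \<times> H. \<Sum>\<xi>\<in>UNIV - {0}.
      of_bool (fst x + \<xi> * snd x = fst y + \<xi> * snd y))"
    by (subst sum.swap) (intro sum.cong refl, subst sum.swap, simp)
  also have "\<dots> \<le> (\<Sum>x\<in>H \<times> H. \<Sum>y\<in>H \<times> H. of_bool (x = y) * (q - 1) + of_bool (fst x \<noteq> fst y \<and> snd x \<noteq> snd y))"
    by (intro sum_mono inner)
  also have "\<dots> = (\<Sum>x\<in>H \<times> H. (q - 1) + (h - 1)\<^sup>2)"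
  proof (intro sum.cong refl)
    fix x assume x: "x \<in> H \<times> H"
    have "(\<Sum>y\<in>H \<times> H. of_bool (x = y) * (q - 1)) = q - 1"
      using x by (simp add: of_bool_def if_distrib[of "\<lambda>u. u * _"] cong: if_cong)
    moreover have "(\<Sum>y\<in>H \<times> H. of_bool (fst x \<noteq> fst y \<and> snd x \<noteq> snd y)) = (h - 1)\<^sup>2"
    proof -
      have "H \<times> H \<inter> {y. fst x \<noteq> fst y \<and> snd x \<noteq> snd y} = (H - {fst x}) \<times> (H - {snd x})"
        by auto
      then have "(\<Sum>y\<in>H \<times> H. of_bool (fst x \<noteq> fst y \<and> snd x \<noteq> snd y)) = card ((H - {fst x}) \<times> (H - {snd x}))"
        by (simp add: of_bool_def sum.If_cases)
      then show ?thesis using x by (auto simp: h_def card_cartesian_product power2_eq_square)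
    qed
    ultimately show "(\<Sum>y\<in>H \<times> H. of_bool (x = y) * (q - 1) + of_bool (fst x \<noteq> fst y \<and> snd x \<noteq> snd y)) = q - 1 + (h - 1)\<^sup>2"
      by (simp add: sum.distrib)
  qed
  also have "\<dots> = h\<^sup>2 * ((q - 1) + (h - 1)\<^sup>2)" by (simp add: h_def card_cartesian_product power2_eq_square)
  finally have "(q - 1) * (2 * h ^ 4) \<le> q * (h\<^sup>2 * ((q - 1) + (h - 1)\<^sup>2))" by simp
  then have "h\<^sup>2 * (2 * h\<^sup>2 * (q - 1)) \<le> h\<^sup>2 * (q * ((q - 1) + (h - 1)\<^sup>2))"
    by (simp add: algebra_simps power2_eq_square power4_eq_xxxx)
  then have ineq: "2 * h\<^sup>2 * (q - 1) \<le> q * ((q - 1) + (h - 1)\<^sup>2)" using two by (simp add: h_def)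
  have q2: "q \<ge> 2"
    unfolding q_def using card_mono[of UNIV "{0, 1 :: 'a}"] by simp
  \<comment> \<open>Shifting \<open>q\<close> and \<open>h\<close> by 2 removes truncated
    subtraction from the identity below, which turns \<open>ineq\<close> into h^2 (q - 2) + 2 h q
    \<le> q^2; this contradicts h^2 \<ge> q + 1.\<close>
  obtain u v where uv: "q = u + 2" "h = v + 2" using q2 two by (metis add.commute h_def le_Suc_ex)
  have hq: "q + 1 \<le> h\<^sup>2" using big by (simp add: q_def h_def)
  have "q * (q - 1) + q * (h - 1)\<^sup>2 + (h\<^sup>2 * (q - 2) + 2 * h * q) = 2 * h\<^sup>2 * (q - 1) + q\<^sup>2"
    by (simp add: uv power2_eq_square algebra_simps)
  moreover have "(q + 1) * (q - 2) \<le> h\<^sup>2 * (q - 2)" using hq by (rule mult_right_mono) simp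
  moreover have "(q + 1) * (q - 2) + 2 * h * q > q\<^sup>2"
    by (simp add: uv power2_eq_square algebra_simps)
  ultimately show False using ineq by (simp add: algebra_simps)
qed

text \<open>Glibichuk's argument: some \<open>H + \<xi> H\<close> fills more than half of the field, and \<open>\<xi>\<close> is a quotient
  of two sums of two elements of \<open>H\<close>; clearing the denominator puts a dilate of \<open>H + \<xi> H\<close> into
  \<open>H + H + H + H\<close>.\<close>

lemma large_subgroup_sum_of_eight:
  fixes H :: "'a :: {field, finite} set"
  assumes mult: "\<And>a b. a \<in> H \<Longrightarrow> b \<in> H \<Longrightarrow> a * b \<in> H"
    and inv: "\<And>a. a \<in> H \<Longrightarrow> inverse a \<in> H" and zero: "0 \<notin> H"
    and big: "CARD('a) < (card H)\<^sup>2" and two: "2 \<le> card H"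
  shows "\<exists>x y :: nat \<Rightarrow> 'a. (\<forall>i<4. x i \<in> H \<and> y i \<in> H) \<and> (\<Sum>i<4. x i + y i) = t"
proof -
  define S where "S = {a + b + (c + d) | a b c d. a \<in> H \<and> b \<in> H \<and> c \<in> H \<and> d \<in> H}"
  let ?f = "\<lambda>\<xi> x. fst x + \<xi> * snd x"
  let ?E = "\<lambda>\<xi>. \<Sum>x\<in>H \<times> H. \<Sum>y\<in>H \<times> H. of_bool (?f \<xi> x = ?f \<xi> y) :: nat"
  obtain \<xi> where \<xi>: "\<xi> \<noteq> 0" "CARD('a) * ?E \<xi> < 2 * card H ^ 4"
    using large_set_exists_dilate_collision_bound[OF big two] by blast
  have half: "CARD('a) < 2 * card (?f \<zeta> ` (H \<times> H))" if "?E \<zeta> = ?E \<xi>" for \<zeta>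
  proof -
    have "card H ^ 4 \<le> card (?f \<zeta> ` (H \<times> H)) * ?E \<zeta>"
      using card_power2_le_image_times_collisions[of "H \<times> H" "?f \<zeta>"]
      by (simp add: card_cartesian_product power2_eq_square power4_eq_xxxx mult.assoc)
    then have "2 * card H ^ 4 \<le> 2 * card (?f \<zeta> ` (H \<times> H)) * ?E \<xi>" unfolding that by (simp add: mult.assoc)
    with \<xi>(2) have "CARD('a) * ?E \<xi> < 2 * card (?f \<zeta> ` (H \<times> H)) * ?E \<xi>" by (rule less_le_trans)
    then show ?thesis unfolding mult_less_cancel2 by (rule conjunct2)
  qed
  have E: "?E \<zeta> = (\<Sum>z\<in>(H \<times> H) \<times> (H \<times> H). of_bool (?f \<zeta> (fst z) = ?f \<zeta> (snd z)))" for \<zeta>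
    unfolding sum.cartesian_product by (intro sum.cong) auto
  \<comment> \<open>Moving the second terms across the equation swaps the second coordinates and
    flips the sign of \<xi>.\<close>
  have E_minus: "?E (- \<xi>) = ?E \<xi>"
    unfolding E
    by (rule sum.reindex_bij_witness[of _ "\<lambda>((a,b),(c,d)). ((a,d),(c,b))" "\<lambda>((a,b),(c,d)). ((a,d),(c,b))"])
      (auto simp: algebra_simps)
  \<comment> \<open>If -1 lies in \<open>H\<close>, minus signs can be absorbed, and a collision
    writes \<xi> as a quotient of differences. Otherwise \<open>- \<xi>\<close> is used to write
    \<xi> as a quotient of sums, whose denominator cannot vanish because -1 is not in
    \<open>H\<close>.\<close>
  have "\<exists>c. c \<noteq> 0 \<and> (\<forall>u \<in> ?f \<xi> ` (H \<times> H). c * u \<in> S)"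
  proof (cases "- 1 \<in> H")
    case True
    have "\<not> inj_on (?f \<xi>) (H \<times> H)"
    proof
      assume "inj_on (?f \<xi>) (H \<times> H)"
      then have "card (H \<times> H) = card (?f \<xi> ` (H \<times> H))" by (simp add: card_image)
      also have "\<dots> \<le> CARD('a)" by (rule card_mono) auto
      finally show False using big by (simp add: card_cartesian_product power2_eq_square)
    qed
    then obtain a1 b1 a2 b2 where H: "a1 \<in> H" "b1 \<in> H" "a2 \<in> H" "b2 \<in> H"
      and e: "a1 + \<xi> * b1 = a2 + \<xi> * b2" and ne: "(a1,b1) \<noteq> (a2,b2)" by (auto simp: inj_on_def)
    have "b2 - b1 \<noteq> 0" using e ne by auto
    moreover have "(b2 - b1) * ?f \<xi> (a,b) \<in> S" if "a \<in> H" "b \<in> H" for a b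
    proof -
      have "(b2 - b1) * \<xi> = a1 - a2" using e by (simp add: algebra_simps)
      then have "(b2 - b1) * (\<xi> * b) = (a1 - a2) * b" by (simp flip: mult.assoc)
      then have "(b2 - b1) * ?f \<xi> (a,b) = b2 * a + (- 1 * b1) * a + (a1 * b + (- 1 * a2) * b)"
        by (simp add: algebra_simps)
      then show ?thesis unfolding S_def using H that mult True by blast
    qed
    ultimately show ?thesis by (intro exI[of _ "b2 - b1"]) auto
  next
    case False
    let ?X = "?f (- \<xi>) ` (H \<times> H)"
    have "card (uminus ` ?X) = card ?X" by (rule card_image) simp
    then have "?X \<inter> uminus ` ?X \<noteq> {}"
      using half[OF E_minus] by (intro card_sum_gt_imp_Int_nonempty) simp
    then obtain a1 b1 a2 b2 where H: "a1 \<in> H" "b1 \<in> H" "a2 \<in> H" "b2 \<in> H"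
      and e: "a1 - \<xi> * b1 = - (a2 - \<xi> * b2)" by force
    have "b1 + b2 \<noteq> 0"
    proof
      assume "b1 + b2 = 0"
      then have "b1 * inverse b2 = - 1" using H zero by (auto simp: field_simps add_eq_0_iff)
      then show False using False mult[OF H(2) inv[OF H(4)]] by simp
    qed
    moreover have "(b1 + b2) * ?f \<xi> (a,b) \<in> S" if "a \<in> H" "b \<in> H" for a b
    proof -
      have "(b1 + b2) * \<xi> = a1 + a2" using e by (simp add: algebra_simps)
      then have "(b1 + b2) * (\<xi> * b) = (a1 + a2) * b" by (simp flip: mult.assoc)
      then have "(b1 + b2) * ?f \<xi> (a,b) = b1 * a + b2 * a + (a1 * b + a2 * b)"
        by (simp add: algebra_simps)
      then show ?thesis unfolding S_def using H that mult by blast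
    qed
    ultimately show ?thesis by (intro exI[of _ "b1 + b2"]) auto
  qed
  then obtain c where c: "c \<noteq> 0" "\<And>u. u \<in> ?f \<xi> ` (H \<times> H) \<Longrightarrow> c * u \<in> S" by blast
  let ?X = "?f \<xi> ` (H \<times> H)"
  have 1: "card ((*) c ` ?X) = card ?X" using c(1) by (intro card_image) (simp add: inj_on_def)
  have 2: "card ((\<lambda>u. t - c * u) ` ?X) = card ?X" using c(1) by (intro card_image) (simp add: inj_on_def)
  \<comment> \<open>Both sets fill more than half of the field, so \<open>t\<close> is a sum of two
    elements of c X, each of them a sum of four elements of \<open>H\<close>.\<close>
  have "(*) c ` ?X \<inter> (\<lambda>u. t - c * u) ` ?X \<noteq> {}"
    using half[OF refl] by (intro card_sum_gt_imp_Int_nonempty) (simp only: 1 2)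
  then obtain u v where uv: "u \<in> ?X" "v \<in> ?X" "c * u = t - c * v" by blast
  have t: "c * u + c * v = t" using uv(3) by simp
  obtain a b a' b' where u: "c * u = a + b + (a' + b')" "a \<in> H" "b \<in> H" "a' \<in> H" "b' \<in> H"
    using c(2)[OF uv(1)] unfolding S_def by blast
  obtain d e d' e' where v: "c * v = d + e + (d' + e')" "d \<in> H" "e \<in> H" "d' \<in> H" "e' \<in> H"
    using c(2)[OF uv(2)] unfolding S_def by blast
  have "(\<Sum>i<4. [a,a',d,d'] ! i + [b,b',e,e'] ! i) = t"
    using t u(1) v(1) by (simp add: eval_nat_numeral add.assoc)
  moreover have "\<forall>i<4. [a,a',d,d'] ! i \<in> H \<and> [b,b',e,e'] ! i \<in> H"
    using u v by (auto simp: less_Suc_eq eval_nat_numeral)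
  ultimately show ?thesis by blast
qed

section \<open>Sums of two powers in a finite field\<close>

text \<open>A subset of an ambient field rather than a type, because a field with q^n elements is
  needed for a variable \<open>n\<close>. It is instantiated both inside \<open>alg_closure\<close>
  and with \<open>UNIV\<close>.\<close>

locale finite_subfield =
  fixes K :: "'b :: field set"
  assumes finite_K: "finite K"
    and zero_K [simp]: "0 \<in> K" and one_K [simp]: "1 \<in> K"
    and add_K [simp]: "\<And>x y. x \<in> K \<Longrightarrow> y \<in> K \<Longrightarrow> x + y \<in> K"
    and uminus_K [simp]: "\<And>x. x \<in> K \<Longrightarrow> - x \<in> K"
    and mult_K [simp]: "\<And>x y. x \<in> K \<Longrightarrow> y \<in> K \<Longrightarrow> x * y \<in> K"
    and inverse_K [simp]: "\<And>x. x \<in> K \<Longrightarrow> inverse x \<in> K"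
begin

lemma diff_K [simp]: "x \<in> K \<Longrightarrow> y \<in> K \<Longrightarrow> x - y \<in> K"
  using add_K[of x "- y"] by simp

lemma divide_K [simp]: "x \<in> K \<Longrightarrow> y \<in> K \<Longrightarrow> x / y \<in> K"
  by (simp add: divide_inverse)

lemma power_K [simp]: "x \<in> K \<Longrightarrow> x ^ (i :: nat) \<in> K"
  by (induction i) auto

lemma card_K_gt_1: "1 < card K"
  using card_mono[OF finite_K, of "{0, 1}"] by simp

text \<open>Packaging \<open>K\<close> as a ring record gives access to the cyclicity of the
  multiplicative group of a finite field.\<close>

lemma exists_primitive_element:
  "\<exists>g \<in> K. g \<noteq> 0 \<and> (\<forall>x \<in> K. x \<noteq> 0 \<longrightarrow> (\<exists>i :: nat. x = g ^ i))"
proof -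
  define R where "R = (\<lparr>carrier = K, monoid.mult = (*), one = 1, ring.zero = 0, add = (+)\<rparr> :: 'b ring)"
  have "field R"
  proof (rule cring.cring_fieldI2)
    show "cring R"
    proof (rule cringI)
      show "abelian_group R"
        by (rule abelian_groupI) (auto simp: R_def add_ac intro: bexI[of _ "- x" for x])
      show "Group.comm_monoid R"
        by (rule comm_monoidI) (auto simp: R_def mult_ac)
    qed (auto simp: R_def algebra_simps)
    show "\<zero>\<^bsub>R\<^esub> \<noteq> \<one>\<^bsub>R\<^esub>" by (simp add: R_def)
    show "\<exists>b\<in>carrier R. a \<otimes>\<^bsub>R\<^esub> b = \<one>\<^bsub>R\<^esub>" if "a \<in> carrier R" "a \<noteq> \<zero>\<^bsub>R\<^esub>" for a
      using that by (intro bexI[of _ "inverse a"]) (auto simp: R_def)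
  qed
  moreover have "finite (carrier R)" using finite_K by (simp add: R_def)
  ultimately obtain g where g: "g \<in> carrier (Multiplicative_Group.mult_of R)"
    and gen: "carrier (Multiplicative_Group.mult_of R) = {g [^]\<^bsub>R\<^esub> i | i :: nat. i \<in> UNIV}"
    using field.finite_field_mult_group_has_gen by blast
  have pow: "g [^]\<^bsub>R\<^esub> i = g ^ i" for i :: nat
    by (induction i) (auto simp: R_def nat_pow_def mult.commute)
  have K: "carrier (Multiplicative_Group.mult_of R) = K - {0}" by (auto simp: R_def)
  have "x \<in> {g ^ i | i :: nat. i \<in> UNIV}" if "x \<in> K" "x \<noteq> 0" for x
    using that gen unfolding K pow by auto
  then show ?thesis using g unfolding K by (intro bexI[of _ g]) auto
qed

section \<open>Multiplicative characters and Jacobi sums\<close>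

definition nontrivial_character :: "('b \<Rightarrow> complex) \<Rightarrow> bool" where
  "nontrivial_character \<chi> \<longleftrightarrow> \<chi> 0 = 0 \<and> (\<forall>x\<in>K. \<forall>y\<in>K. \<chi> (x * y) = \<chi> x * \<chi> y) \<and>
    (\<forall>x\<in>K. x \<noteq> 0 \<longrightarrow> norm (\<chi> x) = 1) \<and> (\<exists>a\<in>K. a \<noteq> 0 \<and> \<chi> a \<noteq> 1)"

lemma sum_K_shift: "a \<in> K \<Longrightarrow> (\<Sum>x\<in>K. f (a - x)) = (\<Sum>x\<in>K. f x)"
  by (rule sum.reindex_bij_witness[of _ "\<lambda>x. a - x" "\<lambda>x. a - x"]) auto

lemma sum_K_translate: "a \<in> K \<Longrightarrow> (\<Sum>x\<in>K. f (x - a)) = (\<Sum>x\<in>K. f x)"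
  by (rule sum.reindex_bij_witness[of _ "\<lambda>x. x + a" "\<lambda>x. x - a"]) auto

lemma sum_K_dilate: "a \<in> K \<Longrightarrow> a \<noteq> 0 \<Longrightarrow> (\<Sum>x\<in>K. f (a * x)) = (\<Sum>x\<in>K. f x)"
  by (rule sum.reindex_bij_witness[of _ "\<lambda>x. x / a" "\<lambda>x. a * x"]) auto

context
  fixes \<chi> assumes chi: "nontrivial_character \<chi>"
begin

lemma character_mult: "x \<in> K \<Longrightarrow> y \<in> K \<Longrightarrow> \<chi> (x * y) = \<chi> x * \<chi> y"
  and character_0: "\<chi> 0 = 0"
  and norm_character: "x \<in> K \<Longrightarrow> x \<noteq> 0 \<Longrightarrow> norm (\<chi> x) = 1"
  using chi by (auto simp: nontrivial_character_def)

lemma character_1: "\<chi> 1 = 1"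
  using character_mult[of 1 1] norm_character[of 1] by auto

lemma sum_character: "(\<Sum>x\<in>K. \<chi> x) = 0"
proof -
  obtain a where a: "a \<in> K" "a \<noteq> 0" "\<chi> a \<noteq> 1" using chi by (auto simp: nontrivial_character_def)
  have "\<chi> a * (\<Sum>x\<in>K. \<chi> x) = (\<Sum>x\<in>K. \<chi> (a * x))"
    using a by (simp add: sum_distrib_left character_mult)
  also have "\<dots> = (\<Sum>x\<in>K. \<chi> x)" using a(1,2) by (rule sum_K_dilate)
  finally show ?thesis using a(3) by (simp add: algebra_simps)
qed

lemma cnj_character: "x \<in> K \<Longrightarrow> x \<noteq> 0 \<Longrightarrow> cnj (\<chi> x) = \<chi> (inverse x)"
proof -
  assume x: "x \<in> K" "x \<noteq> 0"
  have 1: "\<chi> x * \<chi> (inverse x) = 1" using character_mult[of x "inverse x"] x character_1 by simp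
  have 2: "\<chi> x * cnj (\<chi> x) = 1" using norm_character[OF x] by (simp flip: complex_norm_square)
  have "\<chi> x \<noteq> 0" using 1 by auto
  then show ?thesis using 1 2 by (metis mult_left_cancel)
qed

text \<open>For nonzero y the summand is \<open>\<chi> (1 + t / y)\<close>. If t is nonzero, 1 + t /
  y runs through all of \<open>K\<close> except 1, and the full character sum vanishes; if t = 0,
  each of the \<open>card K - 1\<close> terms is 1.\<close>

lemma character_autocorrelation:
  assumes t: "t \<in> K"
  shows "(\<Sum>y\<in>K. \<chi> (y + t) * cnj (\<chi> y)) = (if t = 0 then of_nat (card K) else 0) - 1"
proof -
  have "(\<Sum>y\<in>K. \<chi> (y + t) * cnj (\<chi> y)) = (\<Sum>y\<in>K - {0}. \<chi> (y + t) * cnj (\<chi> y))"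
    using finite_K by (simp add: sum.remove[of K 0] character_0)
  also have "\<dots> = (\<Sum>y\<in>K - {0}. \<chi> (1 + t / y))"
  proof (intro sum.cong refl)
    fix y assume y: "y \<in> K - {0}"
    have "(y + t) * inverse y = 1 + t / y" using y by (simp add: field_simps)
    then show "\<chi> (y + t) * cnj (\<chi> y) = \<chi> (1 + t / y)"
      using y t character_mult[of "y + t" "inverse y"] cnj_character[of y] by simp
  qed
  also have "\<dots> = (if t = 0 then of_nat (card K) else 0) - 1"
  proof (cases "t = 0")
    case True
    then show ?thesis
      using finite_K card_K_gt_1 by (simp add: character_1 card_Diff_singleton of_nat_diff)
  next
    case False
    have "(\<Sum>y\<in>K - {0}. \<chi> (1 + t / y)) = (\<Sum>z\<in>K - {1}. \<chi> z)"
      by (rule sum.reindex_bij_witness[of _ "\<lambda>z. t / (z - 1)" "\<lambda>y. 1 + t / y"])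
        (use t False in auto)
    also have "\<dots> = - 1"
      using finite_K sum_character by (simp add: sum.remove[of K 1] character_1 add_eq_0_iff)
    finally show ?thesis using False by simp
  qed
  finally show ?thesis .
qed

text \<open>By the autocorrelation identity, convolution with \<open>\<chi>\<close> is, on functions of mean zero, an
  isometry up to the factor \<open>sqrt (card K)\<close>.\<close>

lemma character_convolution_norm:
  "(\<Sum>l\<in>K. (norm (\<Sum>x\<in>K. u x * \<chi> (l - x)))\<^sup>2)
    = real (card K) * (\<Sum>x\<in>K. (norm (u x))\<^sup>2) - (norm (\<Sum>x\<in>K. u x))\<^sup>2"
proof -
  have "complex_of_real (\<Sum>l\<in>K. (norm (\<Sum>x\<in>K. u x * \<chi> (l - x)))\<^sup>2)
      = (\<Sum>l\<in>K. (\<Sum>x\<in>K. u x * \<chi> (l - x)) * cnj (\<Sum>y\<in>K. u y * \<chi> (l - y)))"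
    by (simp only: of_real_sum complex_norm_square)
  also have "\<dots> = (\<Sum>l\<in>K. \<Sum>x\<in>K. \<Sum>y\<in>K. u x * cnj (u y) * (\<chi> (l - x) * cnj (\<chi> (l - y))))"
    by (simp add: sum_product mult_ac)
  also have "\<dots> = (\<Sum>x\<in>K. \<Sum>l\<in>K. \<Sum>y\<in>K. u x * cnj (u y) * (\<chi> (l - x) * cnj (\<chi> (l - y))))"
    by (rule sum.swap)
  also have "\<dots> = (\<Sum>x\<in>K. \<Sum>y\<in>K. u x * cnj (u y) * (\<Sum>l\<in>K. \<chi> (l - x) * cnj (\<chi> (l - y))))"
    unfolding sum_distrib_left by (rule sum.cong[OF refl]) (rule sum.swap)
  also have "\<dots> = (\<Sum>x\<in>K. \<Sum>y\<in>K. u x * cnj (u y) * ((if x = y then of_nat (card K) else 0) - 1))"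
  proof (intro sum.cong refl arg_cong[where f = "(*) _"])
    fix x y assume xy: "x \<in> K" "y \<in> K"
    have "(\<Sum>l\<in>K. \<chi> (l - x) * cnj (\<chi> (l - y))) = (\<Sum>l\<in>K. \<chi> (l - y + (y - x)) * cnj (\<chi> (l - y)))" by simp
    also have "\<dots> = (\<Sum>l\<in>K. \<chi> (l + (y - x)) * cnj (\<chi> l))"
      using sum_K_translate[OF xy(2), of "\<lambda>l. \<chi> (l + (y - x)) * cnj (\<chi> l)"] .
    also have "\<dots> = (if x = y then of_nat (card K) else 0) - 1"
      using character_autocorrelation[of "y - x"] xy by simp
    finally show "(\<Sum>l\<in>K. \<chi> (l - x) * cnj (\<chi> (l - y))) = (if x = y then of_nat (card K) else 0) - 1" .
  qed
  also have "\<dots> = of_nat (card K) * (\<Sum>x\<in>K. u x * cnj (u x)) - (\<Sum>x\<in>K. u x) * cnj (\<Sum>y\<in>K. u y)"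
  proof -
    define s where "s = cnj (\<Sum>y\<in>K. u y)"
    have "(\<Sum>y\<in>K. u x * cnj (u y) * ((if x = y then of_nat (card K) else 0) - 1))
        = of_nat (card K) * (u x * cnj (u x)) - u x * s" if "x \<in> K" for x
      using that finite_K
      by (simp add: s_def right_diff_distrib sum_subtractf if_distrib[of "(*) _"] sum_distrib_left cong: if_cong)
    then show ?thesis
      unfolding s_def[symmetric] by (simp add: sum_subtractf flip: sum_distrib_left sum_distrib_right)
  qed
  also have "\<dots> = complex_of_real (real (card K) * (\<Sum>x\<in>K. (norm (u x))\<^sup>2) - (norm (\<Sum>x\<in>K. u x))\<^sup>2)"
    by (simp only: of_real_diff of_real_mult of_real_sum complex_norm_square of_real_of_nat_eq)
  finally show ?thesis by (simp only: of_real_eq_iff)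
qed

end

text \<open>By dilation all sums with nonzero \<open>l\<close> have the same norm. With Q =
  \<open>card K\<close>, the squares of these norms add up to at most Q (Q - 1), by the convolution
  identity applied to \<open>\<psi>\<close>, which has mean zero.\<close>

lemma Jacobi_sum_bound:
  assumes chi: "nontrivial_character \<chi>" and psi: "nontrivial_character \<psi>" and l: "l \<in> K" "l \<noteq> 0"
  shows "norm (\<Sum>x\<in>K. \<psi> x * \<chi> (l - x)) \<le> sqrt (card K)"
proof -
  define J where "J m = (\<Sum>x\<in>K. \<psi> x * \<chi> (m - x))" for m
  have J: "norm (J m) = norm (J 1)" if m: "m \<in> K" "m \<noteq> 0" for m
  proof -
    have "J m = (\<Sum>x\<in>K. \<psi> (m * x) * \<chi> (m - m * x))"
      unfolding J_def using sum_K_dilate[OF m, of "\<lambda>x. \<psi> x * \<chi> (m - x)"] by simp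
    also have "\<dots> = (\<Sum>x\<in>K. \<psi> m * \<chi> m * (\<psi> x * \<chi> (1 - x)))"
    proof (intro sum.cong refl)
      fix x assume x: "x \<in> K"
      have "m - m * x = m * (1 - x)" by (simp add: algebra_simps)
      then show "\<psi> (m * x) * \<chi> (m - m * x) = \<psi> m * \<chi> m * (\<psi> x * \<chi> (1 - x))"
        using character_mult[OF psi, of m x] character_mult[OF chi, of m "1 - x"] m x by simp
    qed
    also have "\<dots> = \<psi> m * \<chi> m * J 1" by (simp add: J_def sum_distrib_left)
    finally show ?thesis using norm_character[OF chi m] norm_character[OF psi m] by (simp add: norm_mult)
  qed
  have Q: "real (card (K - {0})) = real (card K) - 1"
    using finite_K card_K_gt_1 by (simp add: card_Diff_singleton of_nat_diff)
  have "(real (card K) - 1) * (norm (J l))\<^sup>2 = (\<Sum>m\<in>K - {0}. (norm (J m))\<^sup>2)"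
  proof -
    have "(\<Sum>m\<in>K - {0}. (norm (J m))\<^sup>2) = (\<Sum>m\<in>K - {0}. (norm (J l))\<^sup>2)"
    proof (rule sum.cong[OF refl])
      fix m assume "m \<in> K - {0}"
      then show "(norm (J m))\<^sup>2 = (norm (J l))\<^sup>2" using J[of m] J[OF l] by simp
    qed
    then show ?thesis by (simp only: sum_constant Q)
  qed
  also have "\<dots> \<le> (\<Sum>m\<in>K. (norm (J m))\<^sup>2)" using finite_K by (intro sum_mono2) auto
  also have "\<dots> = real (card K) * (\<Sum>x\<in>K. (norm (\<psi> x))\<^sup>2)"
    unfolding J_def character_convolution_norm[OF chi] by (simp add: sum_character[OF psi])
  also have "(\<Sum>x\<in>K. (norm (\<psi> x))\<^sup>2) = real (card K) - 1"
  proof -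
    have "(\<Sum>x\<in>K. (norm (\<psi> x))\<^sup>2) = (\<Sum>x\<in>K - {0}. (norm (\<psi> x))\<^sup>2)"
      using finite_K by (simp add: sum.remove[of K 0] character_0[OF psi])
    also have "\<dots> = (\<Sum>x\<in>K - {0}. 1)" by (intro sum.cong) (auto simp: norm_character[OF psi])
    finally show ?thesis by (simp only: sum_constant Q mult_1_right)
  qed
  finally have "(real (card K) - 1) * (norm (J l))\<^sup>2 \<le> (real (card K) - 1) * real (card K)"
    by (simp add: mult.commute)
  then have "(norm (J l))\<^sup>2 \<le> real (card K)" using card_K_gt_1 by simp
  then show ?thesis unfolding J_def by (rule real_le_rsqrt)
qed

text \<open>Pigeonhole yields some m with 0 < m \<le> \<open>card K - 1\<close> and g^m = 1. All
  powers of \<open>g\<close> then occur among the first m; as they exhaust the nonzero elements, m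
  equals \<open>card K - 1\<close> and these powers are distinct.\<close>

lemma primitive_element_power_eq_iff:
  assumes g: "g \<in> K" "g \<noteq> 0" and gen: "\<And>x. x \<in> K \<Longrightarrow> x \<noteq> 0 \<Longrightarrow> \<exists>i :: nat. x = g ^ i"
  shows "g ^ i = g ^ j \<longleftrightarrow> [i = j] (mod (card K - 1))"
proof -
  define N where "N = card K - 1"
  have N: "card (K - {0}) = N" using finite_K by (simp add: N_def card_Diff_singleton)
  have "\<exists>i j. i < j \<and> j \<le> N \<and> g ^ i = g ^ j"
  proof (rule ccontr)
    assume "\<not> ?thesis"
    then have "inj_on ((^) g) {..N}" unfolding inj_on_def by (metis atMost_iff linorder_neqE_nat)
    then have "card {..N} \<le> card (K - {0})"
      by (rule card_inj_on_le) (use g finite_K in auto)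
    then show False using N by simp
  qed
  then obtain i0 j0 where ij: "i0 < j0" "j0 \<le> N" "g ^ i0 = g ^ j0" by blast
  define m where "m = j0 - i0"
  have "g ^ i0 * g ^ m = g ^ j0" using ij(1) by (simp add: m_def flip: power_add)
  then have "g ^ i0 * g ^ m = g ^ i0 * 1" using ij(3) by simp
  then have gm: "g ^ m = 1" using g(2) by simp
  have m: "0 < m" "m \<le> N" using ij by (auto simp: m_def)
  have pow_mod: "g ^ i = g ^ (i mod m)" for i
  proof -
    have "g ^ i = g ^ (m * (i div m) + i mod m)" by simp
    also have "\<dots> = g ^ (i mod m)" unfolding power_add power_mult by (simp add: gm)
    finally show ?thesis .
  qed
  have sub: "K - {0} \<subseteq> (^) g ` {..<m}"
  proof
    fix x assume "x \<in> K - {0}"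
    then obtain i where "x = g ^ i" using gen by blast
    then have "x = g ^ (i mod m)" using pow_mod by simp
    then show "x \<in> (^) g ` {..<m}" using m by auto
  qed
  have "N \<le> card ((^) g ` {..<m})" using card_mono[OF _ sub] N by simp
  moreover have "card ((^) g ` {..<m}) \<le> m" using card_image_le[of "{..<m}" "(^) g"] by simp
  ultimately have mN: "m = N" and "card ((^) g ` {..<m}) = card {..<m}" using m by auto
  then have inj: "inj_on ((^) g) {..<m}" by (simp add: eq_card_imp_inj_on)
  have "g ^ i = g ^ j \<longleftrightarrow> g ^ (i mod m) = g ^ (j mod m)" using pow_mod by simp
  also have "\<dots> \<longleftrightarrow> i mod m = j mod m" using inj_on_eq_iff[OF inj] m by simp
  finally show ?thesis by (simp add: cong_def mN N_def)
qed

text \<open>With \<open>e = gcd k (card K - 1)\<close>, the sum \<open>w x\<close> over the characters of order dividing \<open>e\<close> vanishes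
  unless \<open>x\<close> is a \<open>k\<close>-th power; the \<open>(e - 1)\<^sup>2\<close> nontrivial Jacobi sums are the error term in the
  count of solutions.\<close>

lemma sum_of_two_kth_powers:
  assumes k: "k \<ge> 1" and big: "(k - 1) ^ 4 < card K" and l: "l \<in> K"
  shows "\<exists>x\<in>K. \<exists>y\<in>K. x ^ k + y ^ k = l"
proof (cases "l = 0")
  case True
  then show ?thesis using k by (intro bexI[of _ 0]) auto
next
  case False
  define N where "N = card K - 1"
  obtain g where g: "g \<in> K" "g \<noteq> 0" and gen: "\<And>x. x \<in> K \<Longrightarrow> x \<noteq> 0 \<Longrightarrow> \<exists>i :: nat. x = g ^ i"
    using exists_primitive_element by blast
  note g_eq = primitive_element_power_eq_iff[OF g gen, folded N_def]
  define e where "e = gcd k N"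
  have e: "e dvd N" "e dvd k" "e > 0" using k by (auto simp: e_def)
  have ek: "e \<le> k" using k e by (auto intro: dvd_imp_le)
  define \<omega> where "\<omega> = cis (2 * pi / real e)"
  have \<omega>_e: "\<omega> ^ e = 1" using e by (simp add: \<omega>_def DeMoivre)
  have \<omega>_1: "e dvd i" if "\<omega> ^ i = 1" for i
  proof -
    have "cis (2 * pi * real i / real e) = 1" using that by (simp add: \<omega>_def DeMoivre mult_ac)
    then have "cos (2 * pi * real i / real e) = 1" by (simp add: complex_eq_iff)
    then obtain m :: int where "2 * pi * real i / real e = of_int m * 2 * pi"
      by (auto simp: cos_one_2pi_int)
    then have "real i = real_of_int m * real e" using e by (simp add: field_simps)
    then have "int i = m * int e" by (metis of_int_eq_iff of_int_mult of_int_of_nat_eq)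
    then show ?thesis by (metis dvd_triv_right of_nat_dvd_iff)
  qed
  have \<omega>_cong: "\<omega> ^ i = \<omega> ^ j" if "[i = j] (mod e)" for i j
  proof -
    have mod: "\<omega> ^ i = \<omega> ^ (i mod e)" for i
    proof -
      have "\<omega> ^ i = \<omega> ^ (e * (i div e) + i mod e)" by simp
      also have "\<dots> = \<omega> ^ (i mod e)" unfolding power_add power_mult by (simp add: \<omega>_e)
      finally show ?thesis .
    qed
    show ?thesis using mod[of i] mod[of j] that by (simp add: cong_def)
  qed
  \<comment> \<open>The exponent is determined only modulo \<open>N\<close>; as \<open>e\<close>
    divides \<open>N\<close>, powers of \<open>\<omega>\<close> do not see the choice.\<close>
  define dlog where "dlog x = (SOME i :: nat. x = g ^ i)" for x
  have dlog: "g ^ dlog x = x" if "x \<in> K" "x \<noteq> 0" for x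
    unfolding dlog_def using gen[OF that] by (metis (mono_tags, lifting) someI_ex)
  define \<chi> where "\<chi> j x = (if x = 0 then 0 else (\<omega> ^ dlog x) ^ j)" for j x
  have \<chi>_g: "\<omega> ^ dlog (g ^ i) = \<omega> ^ i" for i
  proof -
    have "g ^ dlog (g ^ i) = g ^ i" using g by (intro dlog) auto
    then have "[dlog (g ^ i) = i] (mod N)" by (simp add: g_eq)
    then show ?thesis using e(1) by (intro \<omega>_cong) (rule cong_dvd_modulus_nat)
  qed
  have nontriv: "nontrivial_character (\<chi> j)" if j: "j \<in> {1..<e}" for j
  proof -
    have "\<chi> j (x * y) = \<chi> j x * \<chi> j y" if "x \<in> K" "y \<in> K" for x y
    proof (cases "x = 0 \<or> y = 0")
      case False
      have "x * y = g ^ (dlog x + dlog y)" using dlog that False by (simp add: power_add)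
      then have "\<omega> ^ dlog (x * y) = \<omega> ^ dlog x * \<omega> ^ dlog y"
        using \<chi>_g[of "dlog x + dlog y"] by (simp only: power_add)
      then show ?thesis using False by (simp add: \<chi>_def power_mult_distrib)
    qed (auto simp: \<chi>_def)
    moreover have "norm (\<chi> j x) = 1" if "x \<noteq> 0" for x
      using that by (simp add: \<chi>_def \<omega>_def norm_power)
    moreover have "\<chi> j g \<noteq> 1"
    proof
      assume "\<chi> j g = 1"
      then have "\<omega> ^ j = 1" using \<chi>_g[of 1] g by (simp add: \<chi>_def)
      then show False using \<omega>_1[of j] j by (auto dest: dvd_imp_le)
    qed
    ultimately show ?thesis unfolding nontrivial_character_def using g by (auto simp: \<chi>_def)
  qed
  define A where "A x = (\<Sum>j\<in>{1..<e}. \<chi> j x)" for x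
  \<comment> \<open>At nonzero x this is a full geometric sum, hence \<open>e\<close> or 0; at 0 the
    convention \<open>\<chi> j 0 = 0\<close> makes it 1, in accordance with 0 being a k-th
    power.\<close>
  define w where "w x = 1 + A x" for x
  have kth_power: "\<exists>y\<in>K. y ^ k = x" if x: "x \<in> K" and w: "w x \<noteq> 0" for x
  proof (cases "x = 0")
    case True
    then show ?thesis using k by (intro bexI[of _ 0]) auto
  next
    case False
    define i where "i = dlog x"
    have "w x = (\<Sum>j<e. (\<omega> ^ i) ^ j)"
      using e(3) False by (simp add: w_def A_def \<chi>_def i_def lessThan_atLeast0 sum.atLeast_Suc_lessThan)
    moreover have "(\<omega> ^ i) ^ e = 1" using \<omega>_e by (metis mult.commute power_mult power_one)
    ultimately have "\<omega> ^ i = 1" using w geometric_sum[of "\<omega> ^ i" e] by auto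
    then obtain m where m: "i = e * m" using \<omega>_1 by (auto elim: dvdE)
    \<comment> \<open>Bezout: \<open>k * s\<close> is congruent to \<open>e\<close> modulo
      \<open>N\<close>, so g^(e m) is the k-th power of g^(s m).\<close>
    obtain s t where st: "k * s = N * t + e"
      using bezout_nat[of k N] k by (auto simp: e_def)
    have "s * m * k = N * (t * m) + i"
      using arg_cong[OF st, of "\<lambda>u. u * m"] by (simp add: m algebra_simps)
    then have "(g ^ (s * m)) ^ k = g ^ (N * (t * m) + i)" by (simp only: flip: power_mult)
    also have "\<dots> = g ^ i" by (simp add: g_eq cong_def)
    also have "\<dots> = x" unfolding i_def using x False by (rule dlog)
    finally show ?thesis using g by (intro bexI[of _ "g ^ (s * m)"]) auto
  qed
  have sum_A: "(\<Sum>x\<in>K. A x) = 0"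
    unfolding A_def by (subst sum.swap) (simp add: sum_character[OF nontriv])
  define E where "E = (\<Sum>x\<in>K. A x * A (l - x))"
  have "(\<Sum>x\<in>K. w x * w (l - x)) = of_nat (card K) + (\<Sum>x\<in>K. A x) + (\<Sum>x\<in>K. A (l - x)) + E"
    by (simp add: w_def E_def algebra_simps sum.distrib)
  then have count: "(\<Sum>x\<in>K. w x * w (l - x)) = of_nat (card K) + E"
    using sum_K_shift[OF l, of A] by (simp add: sum_A)
  have "E = (\<Sum>i\<in>{1..<e}. \<Sum>j\<in>{1..<e}. \<Sum>x\<in>K. \<chi> i x * \<chi> j (l - x))"
    unfolding E_def A_def sum_product by (subst sum.swap, rule sum.cong[OF refl], rule sum.swap)
  then have "norm E \<le> (\<Sum>i\<in>{1..<e}. \<Sum>j\<in>{1..<e}. sqrt (card K))"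
    by (simp only:) (intro sum_norm_le Jacobi_sum_bound nontriv l False)
  also have "\<dots> = (real (e - 1))\<^sup>2 * sqrt (card K)"
    using e(3) by (simp add: power2_eq_square of_nat_diff)
  also have "\<dots> < real (card K)"
  proof -
    have "((real (e - 1))\<^sup>2)\<^sup>2 = real ((e - 1) ^ 4)" by simp
    also have "\<dots> \<le> real ((k - 1) ^ 4)" using ek by (intro of_nat_mono power_mono) auto
    also have "\<dots> < real (card K)" using big by (simp only: of_nat_less_iff)
    finally have "(real (e - 1))\<^sup>2 < sqrt (card K)" by (rule real_less_rsqrt)
    then have "(real (e - 1))\<^sup>2 * sqrt (card K) < sqrt (card K) * sqrt (card K)"
      using card_K_gt_1 by (intro mult_strict_right_mono) auto
    then show ?thesis by simp
  qed
  finally have "norm E < norm (of_nat (card K) :: complex)" by simp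
  then have "of_nat (card K) + E \<noteq> 0" by (metis add_eq_0_iff less_irrefl norm_minus_cancel)
  then have "(\<Sum>x\<in>K. w x * w (l - x)) \<noteq> 0" unfolding count .
  then have "\<exists>x\<in>K. w x * w (l - x) \<noteq> 0" by (meson sum.not_neutral_contains_not_neutral)
  then obtain x where x: "x \<in> K" "w x \<noteq> 0" "w (l - x) \<noteq> 0" by auto
  then obtain y z where "y \<in> K" "y ^ k = x" "z \<in> K" "z ^ k = l - x"
    using kth_power[of x] kth_power[of "l - x"] l by auto
  then show ?thesis by (intro bexI[of _ y] bexI[of _ z]) auto
qed

end

section \<open>Scalar matrices\<close>

lemma (in finite_subfield) power_card_K:
  assumes "x \<in> K"
  shows "x ^ card K = x"
proof (cases "x = 0")
  case True
  then show ?thesis using card_K_gt_1 by simp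
next
  case False
  obtain g where g: "g \<in> K" "g \<noteq> 0" and gen: "\<And>x. x \<in> K \<Longrightarrow> x \<noteq> 0 \<Longrightarrow> \<exists>i :: nat. x = g ^ i"
    using exists_primitive_element by blast
  obtain i where i: "x = g ^ i" using gen[OF assms False] by blast
  have "i * card K = i * (card K - 1) + i" using card_K_gt_1 by (cases "card K") auto
  then have "g ^ (i * card K) = g ^ i"
    using primitive_element_power_eq_iff[OF g gen, of "i * card K" i] by (simp add: cong_def)
  then show ?thesis by (simp add: i power_mult)
qed

text \<open>A repeated linear factor would make its root a common zero of \<open>f\<close> and
  \<open>pderiv f\<close>, so \<open>f\<close> splits into distinct factors.\<close>

lemma card_roots_eq_degree:
  fixes f :: "'a :: alg_closed_field poly"
  assumes f: "f \<noteq> 0" and sep: "\<And>x. poly f x = 0 \<Longrightarrow> poly (pderiv f) x \<noteq> 0"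
  shows "card {x. poly f x = 0} = degree f"
proof -
  obtain A where A: "size A = degree f" "f = smult (lead_coeff f) (\<Prod>x\<in>#A. [:-x, 1:])"
    using alg_closed_imp_factorization[OF f] by blast
  have roots: "{x. poly f x = 0} = set_mset A"
    using f by (subst A(2)) (auto simp: poly_prod_mset prod_mset_zero_iff)
  have "count A x = 1" if x: "x \<in># A" for x
  proof (rule ccontr)
    assume "count A x \<noteq> 1"
    moreover have "count A x > 0" using x by simp
    ultimately have "count A x > 1" by linarith
    then have "x \<in># A - {#x#}" by (simp add: in_diff_count)
    then obtain B where B: "A = add_mset x (add_mset x B)" using x by (metis insert_DiffM)
    define r where "r = smult (lead_coeff f) (\<Prod>x\<in>#B. [:-x, 1:])"
    have fr: "f = [:-x, 1:] * ([:-x, 1:] * r)" by (subst A(2)) (simp add: B r_def)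
    have "poly (pderiv f) x = 0" unfolding fr pderiv_mult by simp
    moreover have "poly f x = 0" by (subst fr) simp
    ultimately show False using sep by blast
  qed
  then have "size A = card (set_mset A)" by (simp add: size_multiset_overloaded_eq)
  then show ?thesis using A roots by simp
qed

context
  fixes Q p m :: nat and T :: "'b :: alg_closed_field itself"
  assumes p: "prime p" "CHAR('b) = p" and Q: "Q = p ^ m" "m > 0"
begin

text \<open>The fixed points are the roots of X^Q - X, which is separable because its derivative is
  -1 in characteristic p.\<close>

lemma card_fixed_points_Frobenius: "card {x :: 'b. x ^ Q = x} = Q"
proof -
  have "Q > 1" unfolding Q using prime_gt_1_nat[OF p(1)] Q(2) by (rule one_less_power)
  define f :: "'b poly" where "f = monom 1 Q - [:0, 1:]"
  have deg: "degree f = Q"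
    unfolding f_def using \<open>Q > 1\<close> by (simp add: diff_conv_add_uminus degree_add_eq_left degree_monom_eq del: add_uminus_conv_diff)
  have "f \<noteq> 0" using deg \<open>Q > 1\<close> by auto
  have "of_nat Q = (0 :: 'b)" using p Q by (simp add: of_nat_eq_0_iff_char_dvd)
  then have "pderiv f = [:- 1:]" by (simp add: f_def pderiv_diff pderiv_monom pderiv_pCons)
  then have "card {x. poly f x = 0} = Q" using card_roots_eq_degree[OF \<open>f \<noteq> 0\<close>] deg by simp
  moreover have "{x. poly f x = 0} = {x. x ^ Q = x}" by (auto simp: f_def poly_monom)
  ultimately show ?thesis by simp
qed

lemma finite_subfield_fixed_points_Frobenius: "finite_subfield {x :: 'b. x ^ Q = x}"
proof
  have Q0: "Q > 0" using p Q by (simp add: prime_gt_0_nat)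
  show "finite {x :: 'b. x ^ Q = x}"
    using card_fixed_points_Frobenius Q0 by (metis card.infinite less_irrefl)
  show add: "x + y \<in> {x. x ^ Q = x}" if "x \<in> {x. x ^ Q = x}" "y \<in> {x. x ^ Q = x}" for x y :: 'b
    using that freshmans_dream'[of Q m x y] p Q by simp
  show "- x \<in> {x. x ^ Q = x}" if "x \<in> {x. x ^ Q = x}" for x :: 'b
  proof -
    \<comment> \<open>Expanding the power of x + (- x) = 0 treats odd and even \<open>Q\<close>
      alike.\<close>
    have "(x + - x) ^ Q = x ^ Q + (- x) ^ Q" using freshmans_dream'[of Q m x "- x"] p Q by simp
    then show ?thesis using that Q0 by (simp add: add_eq_0_iff power_0_left)
  qed
qed (use Q p in \<open>auto simp: power_mult_distrib power_inverse prime_gt_0_nat power_0_left\<close>)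

end

text \<open>A primitive element \<theta> has n independent powers: if \<theta>^j were a combination
  of lower ones, those j powers would span \<open>K\<close>, forcing q^n \<le> q^j. Counting then
  makes the injective coefficient map bijective. \<open>PiE\<close> fixes the values outside
  \<open>{..<n}\<close>, so that uniqueness makes sense.\<close>

lemma power_basis_finite_field:
  fixes K :: "'a :: {field, finite} alg_closure set"
  assumes K: "finite_subfield K" and card: "card K = CARD('a) ^ n" and sub: "range to_ac \<subseteq> K"
  shows "\<exists>\<theta> \<in> K. \<forall>z \<in> K. \<exists>!f. f \<in> PiE {..<n} (\<lambda>_. UNIV) \<and> (\<Sum>i<n. to_ac (f i) * \<theta> ^ i) = z"
proof -
  interpret finite_subfield K by fact
  define q where "q = CARD('a)"
  have q: "q > 1" unfolding q_def using card_mono[of UNIV "{0, 1 :: 'a}"] by simp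
  obtain \<theta> where \<theta>: "\<theta> \<in> K" "\<theta> \<noteq> 0" and gen: "\<And>x. x \<in> K \<Longrightarrow> x \<noteq> 0 \<Longrightarrow> \<exists>i :: nat. x = \<theta> ^ i"
    using exists_primitive_element by blast
  define ev where "ev m f = (\<Sum>i<m. to_ac (f i) * \<theta> ^ i)" for m and f :: "nat \<Rightarrow> 'a"
  have to_ac_K: "to_ac a \<in> K" for a :: 'a using sub by auto
  have ev_K: "ev m f \<in> K" for m f
    unfolding ev_def by (induction m) (auto simp: \<theta> to_ac_K)
  have indep: "n \<le> j" if rel: "\<theta> ^ j = ev j c" for j c
  proof -
    have j: "j > 0" using rel by (cases j) (auto simp: ev_def)
    have "\<exists>f. \<theta> ^ i = ev j f" for i
    proof (induction i)
      case 0
      show ?case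
        using j by (intro exI[of _ "\<lambda>i. if i = 0 then 1 else 0"])
          (simp add: ev_def if_distrib[of to_ac] if_distrib[of "\<lambda>u. u * _"] cong: if_cong)
    next
      case (Suc i)
      then obtain f where f: "\<theta> ^ i = ev j f" by blast
      obtain j' where j': "j = Suc j'" using j by (cases j) auto
      \<comment> \<open>Multiplication by \<theta> shifts the coefficients; the overflow at degree
        \<open>j\<close> is rewritten by the relation with coefficients \<open>c\<close>.\<close>
      define f' where "f' i = (if i = 0 then 0 else f (i - 1)) + f j' * c i" for i
      have "\<theta> ^ Suc i = (\<Sum>i<j. to_ac (f i) * \<theta> ^ Suc i)"
        by (simp add: f ev_def sum_distrib_left mult_ac)
      also have "\<dots> = (\<Sum>i<j'. to_ac (f i) * \<theta> ^ Suc i) + to_ac (f j') * ev j c"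
        unfolding rel[symmetric] by (simp add: j')
      also have "(\<Sum>i<j'. to_ac (f i) * \<theta> ^ Suc i) = ev j (\<lambda>i. if i = 0 then 0 else f (i - 1))"
        unfolding ev_def j' by (subst sum.lessThan_Suc_shift) simp
      also have "\<dots> + to_ac (f j') * ev j c = ev j f'"
        unfolding ev_def f'_def by (simp add: sum_distrib_left sum.distrib algebra_simps)
      finally show ?case by blast
    qed
    then have "K \<subseteq> range (ev j)"
    proof -
      assume all: "\<And>i. \<exists>f. \<theta> ^ i = ev j f"
      have "x \<in> range (ev j)" if "x \<in> K" for x
      proof (cases "x = 0")
        case True
        then have "x = ev j (\<lambda>_. 0)" by (simp add: ev_def)
        then show ?thesis by blast
      next
        case False
        then show ?thesis using gen[OF that False] all by blast
      qed
      then show ?thesis by blast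
    qed
    also have "range (ev j) \<subseteq> ev j ` PiE {..<j} (\<lambda>_. UNIV)"
    proof
      fix x assume "x \<in> range (ev j)"
      then obtain f where "x = ev j f" by blast
      then have "x = ev j (restrict f {..<j})" by (simp add: ev_def)
      then show "x \<in> ev j ` PiE {..<j} (\<lambda>_. UNIV)"
        by (intro image_eqI[of x "ev j" "restrict f {..<j}"]) simp_all
    qed
    finally have "card K \<le> card (ev j ` PiE {..<j} (\<lambda>_. UNIV))"
      by (rule card_mono[rotated]) (simp add: finite_PiE)
    also have "\<dots> \<le> card (PiE {..<j} (\<lambda>_. UNIV :: 'a set))" by (rule card_image_le) (simp add: finite_PiE)
    also have "\<dots> = q ^ j" by (simp add: card_PiE q_def)
    finally show ?thesis using q card by (simp flip: q_def)
  qed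
  have inj: "inj_on (ev n) (PiE {..<n} (\<lambda>_. UNIV))"
  proof (rule inj_onI, rule ccontr)
    fix f f' assume f: "f \<in> PiE {..<n} (\<lambda>_. UNIV)" "f' \<in> PiE {..<n} (\<lambda>_. UNIV)"
      and eq: "ev n f = ev n f'" and "f \<noteq> f'"
    then have "\<exists>i<n. f i \<noteq> f' i" by (metis PiE_ext lessThan_iff)
    then have ne: "{i. i < n \<and> f i \<noteq> f' i} \<noteq> {}" by blast
    \<comment> \<open>Dividing by the coefficient at the highest difference expresses \<theta>^j by
      lower powers although j < n, against \<open>indep\<close>.\<close>
    define j where "j = Max {i. i < n \<and> f i \<noteq> f' i}"
    have jin: "j \<in> {i. i < n \<and> f i \<noteq> f' i}" unfolding j_def using ne by (intro Max_in) auto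
    have above: "f i = f' i" if "j < i" "i < n" for i
      using Max_ge[of "{i. i < n \<and> f i \<noteq> f' i}" i] that unfolding j_def by fastforce
    define h where "h i = f i - f' i" for i
    have hj: "h j \<noteq> 0" using jin by (simp add: h_def)
    have "0 = (\<Sum>i<n. to_ac (h i) * \<theta> ^ i)"
      using eq by (simp add: ev_def h_def left_diff_distrib sum_subtractf)
    also have "\<dots> = (\<Sum>i<Suc j. to_ac (h i) * \<theta> ^ i)"
      by (rule sum.mono_neutral_right) (use jin above in \<open>auto simp: h_def not_less Suc_le_eq\<close>)
    finally have "to_ac (h j) * \<theta> ^ j = - (\<Sum>i<j. to_ac (h i) * \<theta> ^ i)" by (simp add: eq_neg_iff_add_eq_0 add.commute)
    then have "\<theta> ^ j = - inverse (to_ac (h j)) * (\<Sum>i<j. to_ac (h i) * \<theta> ^ i)"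
      using hj by (simp add: field_simps)
    also have "\<dots> = ev j (\<lambda>i. - (inverse (h j) * h i))"
      by (simp add: ev_def sum_distrib_left mult_ac flip: sum_negf)
    finally show False using indep jin by fastforce
  qed
  have "card (ev n ` PiE {..<n} (\<lambda>_. UNIV)) = card K"
    using card_image[OF inj] by (simp add: card card_PiE)
  then have img: "ev n ` PiE {..<n} (\<lambda>_. UNIV) = K"
    using finite_K ev_K by (intro card_subset_eq) auto
  show ?thesis
  proof (intro bexI[of _ \<theta>] ballI)
    fix z assume "z \<in> K"
    then obtain f where f: "f \<in> PiE {..<n} (\<lambda>_. UNIV)" "ev n f = z" using img by blast
    then show "\<exists>!f. f \<in> PiE {..<n} (\<lambda>_. UNIV) \<and> (\<Sum>i<n. to_ac (f i) * \<theta> ^ i) = z"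
      unfolding ev_def[symmetric] using inj by (intro ex1I[of _ f]) (auto simp: inj_on_def)
  qed (rule \<theta>)
qed

lemma CHAR_eq_if_CARD_prime_power:
  assumes p: "prime p" "CARD('a :: {field, finite}) = p ^ l"
  shows "CHAR('a) = p"
proof -
  have "CHAR('a) dvd p ^ l" using CHAR_dvd_CARD[where 'a = 'a] p by simp
  moreover have "prime CHAR('a)"
    by (rule prime_CHAR_semidom) (rule finite_imp_CHAR_pos, simp)
  ultimately show ?thesis using p(1) by (metis prime_dvd_power primes_dvd_imp_eq)
qed

text \<open>The matrices are images of elements of the field with \<open>CARD('a) ^ n\<close> elements under its regular
  representation.\<close>

theorem scalar_mat_sum_of_two_kth_powers:
  fixes c :: "'a :: {field, finite}"
  assumes p: "prime p" "CARD('a) = p ^ l" and n: "n > 0" and k: "k \<ge> 1"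
    and big: "(k - 1) ^ 4 < CARD('a) ^ n"
  shows "\<exists>A \<in> carrier_mat n n. \<exists>B \<in> carrier_mat n n. c \<cdot>\<^sub>m 1\<^sub>m n = A ^\<^sub>m k + B ^\<^sub>m k"
proof -
  define Q where "Q = CARD('a) ^ n"
  note char = CHAR_eq_if_CARD_prime_power[OF p]
  have l: "l > 0" using p card_mono[of UNIV "{0, 1 :: 'a}"] by (cases l) auto
  define K where "K = {x :: 'a alg_closure. x ^ Q = x}"
  have QQ: "Q = p ^ (l * n)" "l * n > 0" using p l n by (auto simp: Q_def power_mult)
  have K: "finite_subfield K"
    unfolding K_def by (rule finite_subfield_fixed_points_Frobenius[OF p(1) _ QQ]) (simp add: char)
  have card: "card K = CARD('a) ^ n"
    unfolding K_def Q_def[symmetric] by (rule card_fixed_points_Frobenius[OF p(1) _ QQ]) (simp add: char)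
  interpret F: finite_subfield "UNIV :: 'a set" by standard auto
  have Fq: "a ^ (CARD('a) ^ i) = a" for a :: 'a and i
    by (induction i) (simp_all add: power_mult F.power_card_K[simplified])
  have sub: "range to_ac \<subseteq> K" by (auto simp: K_def Q_def Fq simp flip: to_ac_power)
  interpret finite_subfield K by (rule K)
  obtain x y where xy: "x \<in> K" "y \<in> K" "x ^ k + y ^ k = to_ac c"
    using sum_of_two_kth_powers[OF k big[folded card], of "to_ac c"] sub by blast
  from power_basis_finite_field[OF K card sub] obtain \<theta> where \<theta>: "\<theta> \<in> K"
    and ex': "\<forall>z\<in>K. \<exists>!f. f \<in> PiE {..<n} (\<lambda>_. UNIV) \<and> (\<Sum>i<n. to_ac (f i) * \<theta> ^ i) = z"
    by (elim bexE)
  note ex = bspec[OF ex']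
  define co where "co z = (THE f. f \<in> PiE {..<n} (\<lambda>_. UNIV) \<and> (\<Sum>i<n. to_ac (f i) * \<theta> ^ i) = z)" for z
  have co: "(\<Sum>i<n. to_ac (co z i) * \<theta> ^ i) = z" if "z \<in> K" for z
    using theI'[OF ex[OF that]] unfolding co_def by (rule conjunct2)
  have co_PiE: "co z \<in> PiE {..<n} (\<lambda>_. UNIV)" if "z \<in> K" for z
    using theI'[OF ex[OF that]] unfolding co_def by (rule conjunct1)
  have co_unique: "co z i = f i" if "(\<Sum>i<n. to_ac (f i) * \<theta> ^ i) = z" "z \<in> K" "i < n" for z f i
  proof -
    have "(\<Sum>i<n. to_ac (restrict f {..<n} i) * \<theta> ^ i) = z" using that by simp
    then have "co z = restrict f {..<n}"
      using co[OF that(2)] co_PiE[OF that(2)] by (intro Uniq_D[OF ex1_iff_ex_Uniq[THEN iffD1, THEN conjunct2, OF ex[OF that(2)]]]) auto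
    then show ?thesis using that(3) by simp
  qed
  define cv where "cv z = vec n (co z)" for z
  \<comment> \<open>The matrix of multiplication by \<open>u\<close> in the basis 1, \<theta>, ...,
    \<theta>^(n - 1).\<close>
  define \<phi> where "\<phi> u = mat n n (\<lambda>(i,j). co (u * \<theta> ^ j) i)" for u
  have \<phi>: "\<phi> u \<in> carrier_mat n n" for u by (simp add: \<phi>_def)
  have act: "\<phi> u *\<^sub>v cv z = cv (u * z)" if uz: "u \<in> K" "z \<in> K" for u z
  proof (rule eq_vecI)
    fix i assume "i < dim_vec (cv (u * z))"
    then have i: "i < n" by (simp add: cv_def)
    have "(\<Sum>i<n. to_ac (\<Sum>j<n. co (u * \<theta> ^ j) i * co z j) * \<theta> ^ i)
        = (\<Sum>i<n. \<Sum>j<n. to_ac (co z j) * (to_ac (co (u * \<theta> ^ j) i) * \<theta> ^ i))"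
      by (simp add: to_ac_sum sum_distrib_left mult_ac)
    also have "\<dots> = (\<Sum>j<n. to_ac (co z j) * (\<Sum>i<n. to_ac (co (u * \<theta> ^ j) i) * \<theta> ^ i))"
      unfolding sum_distrib_left by (rule sum.swap)
    also have "\<dots> = (\<Sum>j<n. u * (to_ac (co z j) * \<theta> ^ j))"
      using uz \<theta> by (intro sum.cong refl) (simp add: co)
    also have "\<dots> = u * z" using co[OF uz(2)] by (simp flip: sum_distrib_left)
    finally have "co (u * z) i = (\<Sum>j<n. co (u * \<theta> ^ j) i * co z j)"
      using uz i by (intro co_unique) auto
    then show "(\<phi> u *\<^sub>v cv z) $ i = cv (u * z) $ i"
      using i by (simp add: \<phi>_def cv_def scalar_prod_def lessThan_atLeast0)
  qed (simp add: \<phi>_def cv_def)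
  have act_pow: "\<phi> u ^\<^sub>m r *\<^sub>v cv z = cv (u ^ r * z)" if "u \<in> K" "z \<in> K" for u r z
    using that
  proof (induction r arbitrary: z)
    case 0
    then show ?case using \<phi>[of u] by (simp add: cv_def)
  next
    case (Suc r)
    have "\<phi> u ^\<^sub>m Suc r *\<^sub>v cv z = \<phi> u ^\<^sub>m r *\<^sub>v (\<phi> u *\<^sub>v cv z)"
      using \<phi>[of u] by (simp add: assoc_mult_mat_vec[of _ n n _ n] cv_def)
    also have "\<dots> = cv (u ^ r * (u * z))" using Suc by (simp add: act)
    finally show ?case by (simp add: mult_ac)
  qed
  have cv_add: "cv z + cv z' = cv (z + z')" if "z \<in> K" "z' \<in> K" for z z'
  proof (rule eq_vecI)
    fix i assume "i < dim_vec (cv (z + z'))"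
    then have i: "i < n" by (simp add: cv_def)
    have "co (z + z') i = co z i + co z' i"
      using that i co[OF that(1)] co[OF that(2)]
      by (intro co_unique) (simp_all add: distrib_right sum.distrib)
    then show "(cv z + cv z') $ i = cv (z + z') $ i" using i by (simp add: cv_def)
  qed (simp add: cv_def)
  have cK: "to_ac c \<in> K" using sub by blast
  let ?M = "\<phi> x ^\<^sub>m k + \<phi> y ^\<^sub>m k"
  have M: "?M \<in> carrier_mat n n" using \<phi>[of x] \<phi>[of y] by auto
  have entry: "?M $$ (i,j) = (c \<cdot>\<^sub>m 1\<^sub>m n) $$ (i,j)" if ij: "i < n" "j < n" for i j
  proof -
    have unit: "cv (\<theta> ^ j) = unit_vec n j"
    proof (rule eq_vecI)
      fix i assume "i < dim_vec (unit_vec n j)"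
      then have i: "i < n" by simp
      have "co (\<theta> ^ j) i = (if i = j then 1 else 0)"
        using ij i \<theta>
        by (intro co_unique) (simp_all add: if_distrib[of to_ac] if_distrib[of "\<lambda>u. u * _"] cong: if_cong)
      then show "cv (\<theta> ^ j) $ i = unit_vec n j $ i" using i ij by (simp add: cv_def unit_vec_def)
    qed (simp add: cv_def)
    have "?M *\<^sub>v cv (\<theta> ^ j) = cv (x ^ k * \<theta> ^ j) + cv (y ^ k * \<theta> ^ j)"
      using \<phi>[of x] \<phi>[of y] xy \<theta>
      by (simp add: add_mult_distrib_mat_vec[of _ n n] cv_def[of "\<theta> ^ j"])
        (simp add: act_pow flip: cv_def)
    also have "\<dots> = cv (to_ac c * \<theta> ^ j)" using xy \<theta> by (simp add: cv_add flip: distrib_right)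
    finally have "(?M *\<^sub>v cv (\<theta> ^ j)) $ i = co (to_ac c * \<theta> ^ j) i" using ij by (simp add: cv_def)
    also have "\<dots> = (if i = j then c else 0)"
      using ij \<theta> cK
      by (intro co_unique) (auto simp: if_distrib[of to_ac] if_distrib[of "\<lambda>u. u * _"] cong: if_cong)
    finally have "(?M *\<^sub>v unit_vec n j) $ i = (if i = j then c else 0)" unfolding unit .
    moreover have "(N *\<^sub>v unit_vec n j) $ i = N $$ (i,j)" if "N \<in> carrier_mat n n" for N :: "'a mat"
      using that ij by simp
    note this[OF M]
    ultimately show ?thesis using ij by simp
  qed
  have "?M = c \<cdot>\<^sub>m 1\<^sub>m n"
  proof (rule eq_matI)
    fix i j assume "i < dim_row (c \<cdot>\<^sub>m 1\<^sub>m n)" "j < dim_col (c \<cdot>\<^sub>m 1\<^sub>m n)"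
    then show "?M $$ (i,j) = (c \<cdot>\<^sub>m 1\<^sub>m n) $$ (i,j)" by (intro entry) simp_all
  qed (use \<phi>[of x] \<phi>[of y] in auto)
  then show ?thesis using \<phi> by metis
qed

section \<open>Nonscalar matrices\<close>

lemma pow_mat_commute:
  fixes A :: "'a :: semiring_1 mat"
  assumes A: "A \<in> carrier_mat n n"
  shows "A * A ^\<^sub>m k = A ^\<^sub>m k * A"
proof (induction k)
  case (Suc k)
  have "A * (A ^\<^sub>m k * A) = (A * A ^\<^sub>m k) * A"
    using A by (intro assoc_mult_mat[symmetric, of _ n n _ n _ n]) auto
  then show ?case by (simp add: Suc)
qed (use A in simp)

lemma transpose_pow_mat:
  fixes A :: "'a :: comm_ring_1 mat"
  assumes A: "A \<in> carrier_mat n n"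
  shows "transpose_mat (A ^\<^sub>m k) = transpose_mat A ^\<^sub>m k"
proof (induction k)
  case (Suc k)
  have "transpose_mat (A ^\<^sub>m Suc k) = transpose_mat A * transpose_mat (A ^\<^sub>m k)"
    using A by (simp add: transpose_mult[of _ n n _ n])
  then show ?case using A pow_mat_commute[of "transpose_mat A" n k] by (simp add: Suc)
qed (use A in simp)

text \<open>A matrix is the sum of an upper and a lower triangular matrix whose diagonals can be chosen freely
  subject to their sum.\<close>

lemma sum_of_two_kth_powers_if_diagonal:
  fixes D :: "'a :: field mat"
  assumes D: "D \<in> carrier_mat n n" and diag: "\<And>i. i < n \<Longrightarrow> D $$ (i,i) = x i ^ k + y i ^ k"
    and x: "\<And>i j. i < j \<Longrightarrow> j < n \<Longrightarrow> x i \<noteq> 0 \<or> x j \<noteq> 0" and y: "\<And>i. i < n \<Longrightarrow> y i \<noteq> 0"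
    and k: "of_nat k \<noteq> (0 :: 'a)"
  shows "\<exists>A \<in> carrier_mat n n. \<exists>B \<in> carrier_mat n n. D = A ^\<^sub>m k + B ^\<^sub>m k"
proof -
  \<comment> \<open>Equal diagonal entries must get the same root, so the root taken may differ from
    \<open>x i\<close> or \<open>y i\<close>.\<close>
  define r where "r c = (SOME z :: 'a. z ^ k = c)" for c
  have r: "r (z ^ k) ^ k = z ^ k" for z unfolding r_def by (rule someI) (rule refl)
  define U where "U = mat n n (\<lambda>(i,j). if i < j then D $$ (i,j) else if i = j then x i ^ k else 0)"
  define L where "L = mat n n (\<lambda>(i,j). if j < i then D $$ (i,j) else if i = j then y i ^ k else 0)"
  have sum: "D = U + L" using D diag by (intro eq_matI) (auto simp: U_def L_def)
  have "\<exists>A \<in> carrier_mat n n. upper_triangular A \<and> (\<forall>i<n. A $$ (i,i) = r (U $$ (i,i))) \<and> A ^\<^sub>m k = U"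
    by (rule upper_triangular_has_kth_root) (use x r k in \<open>auto simp: U_def\<close>)
  then obtain A where A: "A \<in> carrier_mat n n" "A ^\<^sub>m k = U" by blast
  have "\<exists>B \<in> carrier_mat n n. upper_triangular B \<and> (\<forall>i<n. B $$ (i,i) = r (transpose_mat L $$ (i,i))) \<and>
      B ^\<^sub>m k = transpose_mat L"
    by (rule upper_triangular_has_kth_root) (use y r k in \<open>auto simp: L_def\<close>)
  then obtain B where B: "B \<in> carrier_mat n n" "B ^\<^sub>m k = transpose_mat L" by blast
  then have "transpose_mat B ^\<^sub>m k = L" using transpose_pow_mat[OF B(1), of k] by simp
  then show ?thesis using A B sum by (intro bexI[of _ A] bexI[of _ "transpose_mat B"]) auto
qed

lemma sum_of_two_kth_powers_similar:
  fixes M D :: "'a :: comm_ring_1 mat"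
  assumes M: "M \<in> carrier_mat n n" and sim: "similar_mat M D"
    and D: "\<exists>A \<in> carrier_mat n n. \<exists>B \<in> carrier_mat n n. D = A ^\<^sub>m k + B ^\<^sub>m k"
  shows "\<exists>A \<in> carrier_mat n n. \<exists>B \<in> carrier_mat n n. M = A ^\<^sub>m k + B ^\<^sub>m k"
proof -
  obtain P Q where wit: "similar_mat_wit M D P Q" using sim unfolding similar_mat_def by blast
  note w = similar_mat_witD2[OF M wit]
  obtain A B where AB: "A \<in> carrier_mat n n" "B \<in> carrier_mat n n" "D = A ^\<^sub>m k + B ^\<^sub>m k" using D by blast
  have conj: "(P * C * Q) ^\<^sub>m k = P * C ^\<^sub>m k * Q" if "C \<in> carrier_mat n n" for C
    by (rule similar_mat_wit_pow_id, rule similar_mat_witI[of _ _ n]) (use w that in auto)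
  have pows: "A ^\<^sub>m k \<in> carrier_mat n n" "B ^\<^sub>m k \<in> carrier_mat n n" using AB by auto
  have "M = P * (A ^\<^sub>m k + B ^\<^sub>m k) * Q" using w AB by simp
  also have "\<dots> = (P * A ^\<^sub>m k + P * B ^\<^sub>m k) * Q" using w(6) pows by (simp add: mult_add_distrib_mat)
  also have "\<dots> = P * A ^\<^sub>m k * Q + P * B ^\<^sub>m k * Q"
    by (rule add_mult_distrib_mat[of _ n n]) (use w pows in auto)
  finally have "M = (P * A * Q) ^\<^sub>m k + (P * B * Q) ^\<^sub>m k" using AB by (simp add: conj)
  then show ?thesis using w AB by (intro bexI[of _ "P * A * Q"] bexI[of _ "P * B * Q"]) auto
qed

text \<open>With N = q - 1 and d = gcd(k, N), Bezout makes every power of g^d a k-th power, and a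
  primitive g gives N / d distinct ones.\<close>

lemma card_kth_powers_ge:
  assumes k: "k \<ge> 1"
  shows "(CARD('a :: {field, finite}) - 1) div gcd k (CARD('a) - 1) \<le> card {x ^ k | x :: 'a. x \<noteq> 0}"
proof -
  interpret finite_subfield "UNIV :: 'a set" by standard auto
  define N where "N = CARD('a) - 1"
  obtain g :: 'a where g: "g \<noteq> 0" and gen: "\<And>x. x \<noteq> 0 \<Longrightarrow> \<exists>i :: nat. x = g ^ i"
    using exists_primitive_element by blast
  have g_eq: "g ^ i = g ^ j \<longleftrightarrow> [i = j] (mod N)" for i j
    unfolding N_def by (rule primitive_element_power_eq_iff) (use g gen in auto)
  define d where "d = gcd k N"
  have d: "d dvd N" "d > 0" using k by (auto simp: d_def)
  obtain s t where st: "k * s = N * t + d" using bezout_nat[of k N] k by (auto simp: d_def)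
  have "inj_on (\<lambda>i. g ^ (d * i)) {..<N div d}"
  proof (rule inj_onI)
    fix i j assume ij: "i \<in> {..<N div d}" "j \<in> {..<N div d}" and eq: "g ^ (d * i) = g ^ (d * j)"
    have less: "d * i < N" if "i < N div d" for i
      using that d by (metis dvd_mult_div_cancel mult_less_mono2)
    have "(d * i) mod N = (d * j) mod N" using eq by (simp add: g_eq cong_def)
    then show "i = j" using less[of i] less[of j] ij d by simp
  qed
  then have "card {..<N div d} \<le> card {x ^ k | x :: 'a. x \<noteq> 0}"
  proof (rule card_inj_on_le)
    show "(\<lambda>i. g ^ (d * i)) ` {..<N div d} \<subseteq> {x ^ k | x :: 'a. x \<noteq> 0}"
    proof
      fix x assume "x \<in> (\<lambda>i. g ^ (d * i)) ` {..<N div d}"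
      then obtain i where i: "x = g ^ (d * i)" by blast
      have "s * i * k = N * (t * i) + d * i"
        using arg_cong[OF st, of "\<lambda>u. u * i"] by (simp add: algebra_simps)
      then have "(g ^ (s * i)) ^ k = g ^ (N * (t * i) + d * i)" by (simp only: flip: power_mult)
      also have "\<dots> = x" by (simp add: g_eq cong_def i)
      finally have "x = (g ^ (s * i)) ^ k" ..
      then show "x \<in> {x ^ k | x :: 'a. x \<noteq> 0}" using g by auto
    qed
  qed simp
  then show ?thesis by (simp add: d_def N_def)
qed

text \<open>-1 is a square neither modulo 3 nor modulo 4; for p = 2 the assumption
  \<open>2 < p ^ l\<close> ensures that 4 divides \<open>p ^ l\<close>.\<close>

lemma Suc_power2_ne_prime_power_2_3:
  assumes "p \<in> {2, 3 :: nat}" and "2 < p ^ l"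
  shows "d\<^sup>2 + 1 \<noteq> p ^ l"
proof
  assume eq: "d\<^sup>2 + 1 = p ^ l"
  have l: "l \<noteq> 0" using assms(2) by (cases l) auto
  show False
  proof (cases "p = 2")
    case True
    then have "l \<ge> 2" using assms(2) l by (cases "l = 1") auto
    then have "4 dvd p ^ l" using True le_imp_power_dvd[of 2 l "2 :: nat"] by simp
    then have "(d\<^sup>2 + 1) mod 4 = 0" using eq by simp
    moreover have "d mod 4 \<in> {0, 1, 2, 3}" by auto
    moreover have "(d\<^sup>2 + 1) mod 4 = ((d mod 4)\<^sup>2 + 1) mod 4" by (metis mod_add_left_eq power_mod)
    ultimately show False by (auto simp flip: numeral_2_eq_2)
  next
    case False
    then have "3 dvd p ^ l" using assms(1) l by (simp add: dvd_power)
    then have "(d\<^sup>2 + 1) mod 3 = 0" using eq by simp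
    moreover have "d mod 3 \<in> {0, 1, 2}" by auto
    moreover have "(d\<^sup>2 + 1) mod 3 = ((d mod 3)\<^sup>2 + 1) mod 3" by (metis mod_add_left_eq power_mod)
    ultimately show False by (auto simp flip: numeral_2_eq_2)
  qed
qed

text \<open>With h = (q - 1) / d, excluding q = d^2 + 1 sharpens d^2 < q to d^2 < q - 1 = h d. Hence
  h \<ge> d + 1 \<ge> 2 and h^2 \<ge> h d + h = q - 1 + h > q. In the excluded case h = d, which is
  below sqrt q.\<close>

lemma card_kth_powers_large:
  fixes k :: nat
  defines "H \<equiv> {x ^ k | x :: 'a :: {field, finite}. x \<noteq> 0}"
  assumes q: "CARD('a) = p ^ l" "p \<in> {2, 3}" "2 < CARD('a)" and k: "k \<ge> 1"
    and d: "(gcd k (CARD('a) - 1))\<^sup>2 < CARD('a)"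
  shows "CARD('a) < (card H)\<^sup>2" and "2 \<le> card H"
proof -
  define d where "d = gcd k (CARD('a) - 1)"
  define h where "h = (CARD('a) - 1) div d"
  have hd: "h * d = CARD('a) - 1" by (simp add: h_def d_def)
  have "d\<^sup>2 + 1 \<noteq> CARD('a)" using Suc_power2_ne_prime_power_2_3[of p l d] q by simp
  then have "d * d < h * d" using assms(6) hd by (simp add: d_def power2_eq_square)
  then have dh: "d + 1 \<le> h" by simp
  have dpos: "d > 0" using k by (simp add: d_def)
  have "h * (d + 1) \<le> h\<^sup>2" unfolding power2_eq_square using dh by (rule mult_le_mono2)
  moreover have "h \<ge> 2" using dh dpos by simp
  ultimately have "CARD('a) < h\<^sup>2" using hd q(3) by simp
  moreover have hH: "h \<le> card H" unfolding h_def d_def H_def by (rule card_kth_powers_ge[OF k])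
  ultimately show "CARD('a) < (card H)\<^sup>2" by (meson less_le_trans power_mono zero_le)
  show "2 \<le> card H" using hH \<open>h \<ge> 2\<close> by simp
qed

text \<open>For k = 1 the logarithm is -\<infinity> and the claim is just 0 < q^n; otherwise the
  hypothesis is exponentiated.\<close>

lemma kth_power_exponent_bound:
  assumes q: "q > 1" and k: "k \<ge> 1"
    and n: "ereal (real n) > 4 * eln (real k - 1) / ereal (ln (real q))"
  shows "(k - 1) ^ 4 < q ^ n"
proof (cases "k = 1")
  case True
  then show ?thesis using q by simp
next
  case False
  define a where "a = real k - 1"
  have a: "a \<ge> 1" "real (k - 1) = a" using False k by (auto simp: a_def)
  have lnq: "ln (real q) > 0" using q by simp
  have "4 * eln a / ereal (ln (real q)) = ereal (4 * ln a / ln (real q))"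
    using a lnq by (simp add: eln_def)
  then have "4 * ln a / ln (real q) < real n" using n by (simp add: a_def)
  then have "4 * ln a < real n * ln (real q)" using lnq by (simp add: field_simps)
  then have "ln (a ^ 4) < ln (real q ^ n)" using a q by (simp add: ln_realpow)
  then have "a ^ 4 < real q ^ n" using a q by (subst (asm) ln_less_cancel_iff) auto
  then have "real ((k - 1) ^ 4) < real (q ^ n)" by (simp only: of_nat_power a)
  then show ?thesis by (simp only: of_nat_less_iff)
qed

lemma nonscalar_sum_of_two_kth_powers:
  fixes M :: "'a :: {field, finite} mat"
  assumes p: "prime p" "CARD('a) = p ^ l" "p \<in> {2, 3}" and k: "k \<ge> 1" "\<not> p dvd k"
    and d: "(gcd k (CARD('a) - 1))\<^sup>2 < CARD('a)"
    and n: "n \<ge> 4" and M: "M \<in> carrier_mat n n" and nsc: "\<not> scalar_mat n M"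
  shows "\<exists>A \<in> carrier_mat n n. \<exists>B \<in> carrier_mat n n. M = A ^\<^sub>m k + B ^\<^sub>m k"
proof -
  have kne: "of_nat k \<noteq> (0 :: 'a)"
    using k(2) CHAR_eq_if_CARD_prime_power[OF p(1,2)] by (simp add: of_nat_eq_0_iff_char_dvd)
  have "\<exists>x y :: nat \<Rightarrow> 'a. (\<forall>i j. i < j \<longrightarrow> j < n \<longrightarrow> x i \<noteq> 0 \<or> x j \<noteq> 0) \<and> (\<forall>i<n. y i \<noteq> 0) \<and>
      (\<Sum>i<n. x i ^ k + y i ^ k) = mat_trace M"
  proof (cases "CARD('a) = 2")
    case True
    have "{0, 1 :: 'a} = UNIV" using True by (intro card_subset_eq) auto
    then have F2: "a = 0 \<or> a = 1" for a :: 'a by blast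
    have "(1 :: 'a) + 1 \<noteq> 1" by (metis add_cancel_right_right one_neq_zero)
    then have two: "(1 :: 'a) + 1 = 0" using F2[of "1 + 1"] by blast
    \<comment> \<open>Over two elements each diagonal entry is 1 + 1 = 0, except that a trace of 1
      is absorbed by a first entry 0 + 1, the single zero that the triangular root
      tolerates.\<close>
    define x where "x i = (if i = 0 \<and> mat_trace M = 1 then 0 else 1 :: 'a)" for i :: nat
    have "(\<Sum>i<n. x i ^ k + 1 ^ k) = (\<Sum>i<n. if i = 0 then mat_trace M else 0)"
      using F2[of "mat_trace M"] two k(1) by (intro sum.cong) (auto simp: x_def)
    also have "\<dots> = mat_trace M" using n by simp
    finally show ?thesis by (intro exI[of _ x] exI[of _ "\<lambda>_. 1"]) (auto simp: x_def)
  next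
    case False
    have "CARD('a) \<ge> 2" using card_mono[of UNIV "{0, 1 :: 'a}"] by simp
    then have q2: "2 < CARD('a)" using False by simp
    define H where "H = {x ^ k | x :: 'a. x \<noteq> 0}"
    have mult: "a * b \<in> H" if "a \<in> H" "b \<in> H" for a b
    proof -
      from that obtain u v where "a = u ^ k" "b = v ^ k" "u \<noteq> 0" "v \<noteq> 0" by (auto simp: H_def)
      then have "a * b = (u * v) ^ k" "u * v \<noteq> 0" by (auto simp: power_mult_distrib)
      then show ?thesis unfolding H_def by blast
    qed
    have inv: "inverse a \<in> H" if "a \<in> H" for a
    proof -
      from that obtain u where "a = u ^ k" "u \<noteq> 0" by (auto simp: H_def)
      then have "inverse a = inverse u ^ k" "inverse u \<noteq> 0" by (auto simp: power_inverse)
      then show ?thesis unfolding H_def by blast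
    qed
    have zero: "0 \<notin> H" by (auto simp: H_def)
    note large = card_kth_powers_large[OF p(2,3) q2 k(1) d, folded H_def]
    \<comment> \<open>Four diagonal entries absorb the trace, each with two of the eight powers;
      every later entry will be 1 + 1, subtracted here in advance.\<close>
    have "\<exists>u v :: nat \<Rightarrow> 'a. (\<forall>i<4. u i \<in> H \<and> v i \<in> H) \<and>
        (\<Sum>i<4. u i + v i) = mat_trace M - (\<Sum>i\<in>{4..<n}. 1 + 1)"
      by (rule large_subgroup_sum_of_eight) (fact mult inv zero large)+
    then obtain u v :: "nat \<Rightarrow> 'a" where uv: "\<And>i. i < 4 \<Longrightarrow> u i \<in> H \<and> v i \<in> H"
      and sum: "(\<Sum>i<4. u i + v i) = mat_trace M - (\<Sum>i\<in>{4..<n}. 1 + 1)"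
      by blast
    define root where "root a = (SOME x :: 'a. x \<noteq> 0 \<and> x ^ k = a)" for a
    have root: "root a \<noteq> 0 \<and> root a ^ k = a" if "a \<in> H" for a
      unfolding root_def by (rule someI_ex) (use that in \<open>auto simp: H_def\<close>)
    define x where "x i = (if i < 4 then root (u i) else 1)" for i
    define y where "y i = (if i < 4 then root (v i) else 1)" for i
    have "{..<n} = {..<4} \<union> {4..<n}" using n by auto
    then have "(\<Sum>i<n. x i ^ k + y i ^ k) = (\<Sum>i<4. x i ^ k + y i ^ k) + (\<Sum>i\<in>{4..<n}. x i ^ k + y i ^ k)"
      by (simp add: sum.union_disjoint ivl_disj_int)
    also have "(\<Sum>i<4. x i ^ k + y i ^ k) = (\<Sum>i<4. u i + v i)"
      by (intro sum.cong) (use uv root in \<open>auto simp: x_def y_def\<close>)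
    also have "(\<Sum>i\<in>{4..<n}. x i ^ k + y i ^ k) = (\<Sum>i\<in>{4..<n}. 1 + 1)"
      by (intro sum.cong) (auto simp: x_def y_def)
    finally have "(\<Sum>i<n. x i ^ k + y i ^ k) = mat_trace M" unfolding sum by simp
    moreover have "x i \<noteq> 0 \<and> y i \<noteq> 0" for i using uv root by (simp add: x_def y_def)
    ultimately show ?thesis by blast
  qed
  then obtain x y :: "nat \<Rightarrow> 'a" where x: "\<And>i j. i < j \<Longrightarrow> j < n \<Longrightarrow> x i \<noteq> 0 \<or> x j \<noteq> 0"
    and y: "\<And>i. i < n \<Longrightarrow> y i \<noteq> 0" and sum: "(\<Sum>i<n. x i ^ k + y i ^ k) = mat_trace M" by blast
  obtain D where D: "D \<in> carrier_mat n n" "similar_mat M D" and diag: "\<And>i. i < n \<Longrightarrow> D $$ (i,i) = x i ^ k + y i ^ k"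
    using nonscalar_similar_prescribed_diagonal[OF M disjI2[OF nsc] sum] by blast
  show ?thesis
    by (rule sum_of_two_kth_powers_similar[OF M D(2)], rule sum_of_two_kth_powers_if_diagonal[OF D(1) diag x y kne])
qed

theorem theorem1p15:
  fixes p l q n k d :: nat
    and M :: "'a :: {field, finite} mat"
  assumes "prime p"
    and "q = p ^ l"
    and "CARD('a) = q"
    and "n \<ge> 2"
    and "k \<ge> 1"
    and "d = gcd k (q - 1)"
    and "q > d\<^sup>2"
    and "\<not> p dvd k"
    and "p \<in> {2, 3}"
    and "ereal (real n) > max 3 (4 * eln (real k - 1) / ereal (ln (real q)))"
    and "M \<in> carrier_mat n n"
  shows "\<exists>A \<in> carrier_mat n n. \<exists>B \<in> carrier_mat n n. M = A ^\<^sub>m k + B ^\<^sub>m k"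
proof (cases "scalar_mat n M")
  case True
  then obtain c where c: "M = c \<cdot>\<^sub>m 1\<^sub>m n" by (auto simp: scalar_mat_def)
  have "q > 1" using assms(3) card_mono[of UNIV "{0, 1 :: 'a}"] by simp
  moreover have "ereal (real n) > 4 * eln (real k - 1) / ereal (ln (real q))" using assms(10) by simp
  ultimately have "(k - 1) ^ 4 < q ^ n" using assms(5) by (intro kth_power_exponent_bound)
  then show ?thesis
    unfolding c using assms by (intro scalar_mat_sum_of_two_kth_powers[of p l]) auto
next
  case False
  \<comment> \<open>The 3 in the maximum supplies the four diagonal entries.\<close>
  have "ereal 3 < ereal (real n)" using assms(10) by simp
  then have "n \<ge> 4" by simp
  then show ?thesis
    using assms False by (intro nonscalar_sum_of_two_kth_powers[of p l]) auto
qed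

end
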